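(* Let $(\varphi,\vec\xi,\eta,g)$ be a K-contact contact metric structure (i.e. a contact metric structure with $L_{\vec\xi}g=0$) on a smooth manifold $X$ of odd dimension $n$, let $D=\ker\eta$, and let $(\tilde D,J,\vec u,\lambda=\eta\circ\pi_*,\tilde g,D)$ be the prolonged almost contact metric structure on the total space of $D$ determined by the $N$-prolonged metric connection (for which here $N=0$). Then this prolonged structure is almost normal if and only if $D$ is a distribution of zero curvature, i.e. the Schouten curvature tensor of the intrinsic metric connection on $D$ vanishes.
   Context: All objects are smooth. An almost contact metric structure $(\varphi,\vec\xi,\eta,g)$ on an odd-dimensional manifold $X$ consists of a $(1,1)$-tensor field $\varphi$, a vector field $\vec\xi$, a 1-form $\eta$ and a (pseudo-)Riemannian metric $g$ with $\eta(\vec\xi)=1$, $\varphi(\vec\xi)=0$, $\eta\circ\varphi=0$, $\varphi^2\vec X=-\vec X+\eta(\vec X)\vec\xi$, $g(\varphi\vec X,\varphi\vec Y)=g(\vec X,\vec Y)-\eta(\vec X)\eta(\vec Y)$ and $d\eta(\vec\xi,\vec X)=0$. Convention: $2\,d\eta(\vec X,\vec Y)=\vec X\eta(\vec Y)-\vec Y\eta(\vec X)-\eta([\vec X,\vec Y])$, and likewise for $d\lambda$. The structure is a contact metric structure if $\Omega=d\eta$, where $\Omega(\vec X,\vec Y)=g(\vec X,\varphi\vec Y)$. Almost normality. An almost contact metric structure with structure endomorphism $\varphi$, structure vector $\vec\xi$ and contact form $\eta$ is almost normal if $N_\varphi+2(d\eta\circ\varphi)\otimes\vec\xi=0$, where $N_\varphi(\vec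 X,\vec Y)=[\varphi\vec X,\varphi\vec Y]+\varphi^2[\vec X,\vec Y]-\varphi[\varphi\vec X,\vec Y]-\varphi[\vec X,\varphi\vec Y]$ and $(d\eta\circ\varphi)(\vec X,\vec Y)=d\eta(\varphi\vec X,\varphi\vec Y)$. For the prolonged structure this reads $N_J+2(d\lambda\circ J)\otimes\vec u=0$. Adapted coordinates. Indices: $\alpha=1,\dots,n$; $a,b,c,d,e=1,\dots,n-1$. A chart $(x^\alpha)$ on $X$ is adapted if $\vec\xi=\partial_n$; then $D=\ker\eta$ is spanned by $\vec e_a=\partial_a-\Gamma^n_a\partial_n$ for functions $\Gamma^n_a$ with $\partial_n\Gamma^n_a=0$, and $\eta=dx^n+\Gamma^n_adx^a$. The total space of $D$, with projection $\pi:D\to X$, is a smooth manifold of dimension $2n-1$ with coordinates $(x^\alpha,x^{n+a})$, where $x^{n+a}$ are the components of a vector of $D$ in the basis $(\vec e_a)$. Intrinsic metric connection and prolongation. Let $p:TX\to D$ be the projection along $\vec\xi$. Let $\nabla:\Gamma D\times\Gamma D\to\Gamma D$ be the unique intrinsic linear connection ($C^\infty(X)$-linear in the first argument, additive and satisfying the Leibniz rule in the second) with $\vec Zg(\vec X,\vec Y)=g(\nabla_{\vec Z}\vec X,\vec Y)+g(\vec X,\nabla_{\vec Z}\vec Y)$ and $\nabla_{\vec X}\vec Y-\nabla_{\vec Y}\vec X=p[\vec X,\vec Y]$ for $\vec X,\vec Y,\vec Z\in\Gamma D$; write $\nabla_{\vec e_a}\vec e_b=\Gamma^c_{ab}\vec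 e_c$. The $N$-prolonged metric connection is the pair $(\nabla,N)$ with $N:D\to D$ given by $g(N\vec X,\vec Y)=\frac12(L_{\vec\xi}g)(\vec X,\vec Y)$ on $D$; in the K-contact case $N=0$. Schouten curvature tensor of $D$: $R(\vec e_a,\vec e_b)\vec e_c=R^d_{abc}\vec e_d$ with $$R^d_{abc}=\vec e_a\Gamma^d_{bc}-\vec e_b\Gamma^d_{ac}+\Gamma^d_{ae}\Gamma^e_{bc}-\Gamma^d_{be}\Gamma^e_{ac}$$ in adapted frames. Equivalently, $R(\vec v,\vec w)\vec z=\nabla_{\vec v}\nabla_{\vec w}\vec z-\nabla_{\vec w}\nabla_{\vec v}\vec z-\nabla_{p[\vec v,\vec w]}\vec z-p[q[\vec v,\vec w],\vec z]$ for $\vec v,\vec w,\vec z\in\Gamma D$, where $q=\mathrm{id}-p$. $D$ is a distribution of zero curvature if $R=0$. Prolonged almost contact metric structure. On the manifold $D$ consider the local frame (with $N=0$) $$\vec\epsilon_a=\partial_a-\Gamma^n_a\partial_n-\Gamma^b_{ac}x^{n+c}\partial_{n+b},\qquad \vec u=\partial_n,\qquad \partial_{n+a}.$$ Then $\tilde D=\pi_*^{-1}(D)=\mathrm{span}(\vec\epsilon_a,\partial_{n+a})=\ker\lambda$, where $\lambda=\eta\circ\pi_*$. The metric $\tilde g$ and endomorphism $J$ are defined by $$\tilde g(\vec\epsilon_a,\vec\epsilon_b)=\tilde g(\partial_{n+a},\partial_{n+b})=g(\vec e_a,\vec e_b),\quad \tilde g(\vec\epsilon_a,\partial_{n+b})=\tilde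 g(\vec\epsilon_a,\vec u)=\tilde g(\vec u,\partial_{n+b})=0,\quad \tilde g(\vec u,\vec u)=1,$$ $$J(\vec\epsilon_a)=\partial_{n+a},\quad J(\partial_{n+a})=-\vec\epsilon_a,\quad J(\vec u)=0.$$ These objects do not depend on the choice of adapted chart; $J$ is the structure endomorphism, $\vec u$ the structure vector field, and $\lambda$ the contact form. *)

theory Defs
  imports "HOL-Analysis.Analysis"
begin

section \<open>Calculus on relatively open subsets of a linear subspace\<close>

text \<open>
  Coordinates take values in a linear subspace \<open>E\<close> of a Euclidean space; tangent vectors in a
  chart are elements of \<open>E\<close>. This lets the total space of a rank \<open>n - 1\<close> distribution be modelled
  on a space of dimension \<open>2 n - 1\<close> with \<open>n = CARD('n)\<close>, the case \<open>n = 1\<close> included.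
\<close>

definition dir_deriv :: "('e::real_normed_vector \<Rightarrow> 'f::real_normed_vector) \<Rightarrow> 'e \<Rightarrow> 'e \<Rightarrow> 'f" where
  "dir_deriv f x v = vector_derivative (\<lambda>t. f (x + t *\<^sub>R v)) (at 0)"

primrec Ck_on :: "nat \<Rightarrow> 'e::real_normed_vector set \<Rightarrow> 'e set \<Rightarrow> ('e \<Rightarrow> 'f::real_normed_vector) \<Rightarrow> bool" where
  "Ck_on 0 E S f \<longleftrightarrow> continuous_on S f"
| "Ck_on (Suc m) E S f \<longleftrightarrow>
     (\<forall>x\<in>S. f differentiable (at x within S)) \<and> (\<forall>v\<in>E. Ck_on m E S (\<lambda>x. dir_deriv f x v))"

definition smooth_on :: "'e::real_normed_vector set \<Rightarrow> 'e set \<Rightarrow> ('e \<Rightarrow> 'f::real_normed_vector) \<Rightarrow> bool" where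
  "smooth_on E S f \<longleftrightarrow> (\<forall>m. Ck_on m E S f)"

definition smooth_field :: "'e::real_normed_vector set \<Rightarrow> 'e set \<Rightarrow> ('e \<Rightarrow> 'e) \<Rightarrow> bool" where
  "smooth_field E S V \<longleftrightarrow> smooth_on E S V \<and> (\<forall>x\<in>S. V x \<in> E)"

definition lie_bracket :: "('e::real_normed_vector \<Rightarrow> 'e) \<Rightarrow> ('e \<Rightarrow> 'e) \<Rightarrow> 'e \<Rightarrow> 'e" where
  "lie_bracket V W x = dir_deriv W x (V x) - dir_deriv V x (W x)"

text \<open>The normalisation is \<open>2 d\<theta>(V, W) = V \<theta>(W) - W \<theta>(V) - \<theta>[V, W]\<close>.\<close>

definition ext_deriv :: "('e::real_normed_vector \<Rightarrow> 'e \<Rightarrow> real) \<Rightarrow> ('e \<Rightarrow> 'e) \<Rightarrow> ('e \<Rightarrow> 'e) \<Rightarrow> 'e \<Rightarrow> real" where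
  "ext_deriv \<theta> V W x =
     (dir_deriv (\<lambda>y. \<theta> y (W y)) x (V x) - dir_deriv (\<lambda>y. \<theta> y (V y)) x (W x)
       - \<theta> x (lie_bracket V W x)) / 2"

definition nijenhuis :: "('e::real_normed_vector \<Rightarrow> 'e \<Rightarrow> 'e) \<Rightarrow> ('e \<Rightarrow> 'e) \<Rightarrow> ('e \<Rightarrow> 'e) \<Rightarrow> 'e \<Rightarrow> 'e" where
  "nijenhuis \<phi> V W x =
     lie_bracket (\<lambda>y. \<phi> y (V y)) (\<lambda>y. \<phi> y (W y)) x + \<phi> x (\<phi> x (lie_bracket V W x))
       - \<phi> x (lie_bracket (\<lambda>y. \<phi> y (V y)) W x) - \<phi> x (lie_bracket V (\<lambda>y. \<phi> y (W y)) x)"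

definition lie_deriv_metric ::
  "('e::real_normed_vector \<Rightarrow> 'e) \<Rightarrow> ('e \<Rightarrow> 'e \<Rightarrow> 'e \<Rightarrow> real) \<Rightarrow> ('e \<Rightarrow> 'e) \<Rightarrow> ('e \<Rightarrow> 'e) \<Rightarrow> 'e \<Rightarrow> real" where
  "lie_deriv_metric Z g V W x =
     dir_deriv (\<lambda>y. g y (V y) (W y)) x (Z x)
       - g x (lie_bracket Z V x) (W x) - g x (V x) (lie_bracket Z W x)"

definition linear_on_space :: "'e::real_vector set \<Rightarrow> ('e \<Rightarrow> 'f::real_vector) \<Rightarrow> bool" where
  "linear_on_space E f \<longleftrightarrow>
     (\<forall>u\<in>E. \<forall>v\<in>E. f (u + v) = f u + f v) \<and> (\<forall>r. \<forall>v\<in>E. f (r *\<^sub>R v) = r *\<^sub>R f v)"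


section \<open>Smooth manifolds\<close>

text \<open>An atlas is a family of charts indexed by the set \<open>charts\<close>.\<close>

record ('i, 'm, 'e) manifold =
  model :: "'e set"
  charts :: "'i set"
  chart_dom :: "'i \<Rightarrow> 'm set"
  chart_map :: "'i \<Rightarrow> 'm \<Rightarrow> 'e"

definition points :: "('i, 'm, 'e) manifold \<Rightarrow> 'm set" where
  "points M = (\<Union>i\<in>charts M. chart_dom M i)"

definition chart_image :: "('i, 'm, 'e) manifold \<Rightarrow> 'i \<Rightarrow> 'e set" where
  "chart_image M i = chart_map M i ` chart_dom M i"

definition transition :: "'m set \<Rightarrow> ('m \<Rightarrow> 'e) \<Rightarrow> ('m \<Rightarrow> 'e) \<Rightarrow> 'e \<Rightarrow> 'e" where
  "transition U f h = h \<circ> the_inv_into U f"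

definition compatible_chart ::
  "('i, 'm, 'e::euclidean_space) manifold \<Rightarrow> 'm set \<Rightarrow> ('m \<Rightarrow> 'e) \<Rightarrow> bool" where
  "compatible_chart M U f \<longleftrightarrow>
     U \<subseteq> points M \<and> inj_on f U \<and> openin (top_of_set (model M)) (f ` U) \<and>
     (\<forall>i\<in>charts M. let W = U \<inter> chart_dom M i; h = chart_map M i in
        openin (top_of_set (model M)) (f ` W) \<and>
        openin (top_of_set (model M)) (h ` W) \<and>
        smooth_on (model M) (f ` W) (transition U f h) \<and>
        smooth_on (model M) (h ` W) (transition (chart_dom M i) h f))"

text \<open>For a compatible atlas the predicate below does define a topology, the unique one in which
  every chart is a homeomorphism from an open set onto its image.\<close>

definition manifold_topology :: "('i, 'm, 'e::euclidean_space) manifold \<Rightarrow> 'm topology" where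
  "manifold_topology M = topology (\<lambda>W. W \<subseteq> points M \<and>
     (\<forall>i\<in>charts M. openin (top_of_set (model M)) (chart_map M i ` (W \<inter> chart_dom M i))))"

text \<open>The last conjunct says that the atlas is maximal.\<close>

definition smooth_manifold :: "('i, 'm, 'e::euclidean_space) manifold \<Rightarrow> bool" where
  "smooth_manifold M \<longleftrightarrow>
     subspace (model M) \<and>
     (\<forall>i\<in>charts M. compatible_chart M (chart_dom M i) (chart_map M i)) \<and>
     Hausdorff_space (manifold_topology M) \<and> second_countable (manifold_topology M) \<and>
     (\<forall>U f. compatible_chart M U f \<longrightarrow>
        (\<exists>i\<in>charts M. chart_dom M i = U \<and> (\<forall>p\<in>U. chart_map M i p = f p)))"

text \<open>The differential of the change of coordinates from chart \<open>i\<close> to chart \<open>j\<close> at the point \<open>p\<close>.\<close>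

definition change_of_chart ::
  "('i, 'm, 'e::real_normed_vector) manifold \<Rightarrow> 'i \<Rightarrow> 'i \<Rightarrow> 'm \<Rightarrow> 'e \<Rightarrow> 'e" where
  "change_of_chart M i j p v =
     dir_deriv (transition (chart_dom M i) (chart_map M i) (chart_map M j)) (chart_map M i p) v"

text \<open>A tangent vector at \<open>p\<close> is the family of its coordinate expressions in the charts around \<open>p\<close>
  (set to zero at all other indices).\<close>

definition tangent_space :: "('i, 'm, 'e::real_normed_vector) manifold \<Rightarrow> 'm \<Rightarrow> ('i \<Rightarrow> 'e) set" where
  "tangent_space M p = {v.
     (\<forall>i. (i \<in> charts M \<and> p \<in> chart_dom M i \<longrightarrow> v i \<in> model M) \<and>
          (\<not> (i \<in> charts M \<and> p \<in> chart_dom M i) \<longrightarrow> v i = 0)) \<and>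
     (\<forall>i\<in>charts M. \<forall>j\<in>charts M. p \<in> chart_dom M i \<inter> chart_dom M j \<longrightarrow>
        v j = change_of_chart M i j p (v i))}"


section \<open>Almost contact metric structures\<close>

text \<open>
  Tensor fields are given by their coordinate expressions: \<open>endo S i x\<close>, \<open>reeb S i x\<close>, \<open>form S i x\<close>
  and \<open>metric S i x\<close> are \<open>\<phi>\<close>, \<open>\<xi>\<close>, \<open>\<eta>\<close> and \<open>g\<close> in chart \<open>i\<close> at the point with coordinates \<open>x\<close>.
\<close>

record ('i, 'e) contact_data =
  endo :: "'i \<Rightarrow> 'e \<Rightarrow> 'e \<Rightarrow> 'e"
  reeb :: "'i \<Rightarrow> 'e \<Rightarrow> 'e"
  form :: "'i \<Rightarrow> 'e \<Rightarrow> 'e \<Rightarrow> real"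
  metric :: "'i \<Rightarrow> 'e \<Rightarrow> 'e \<Rightarrow> 'e \<Rightarrow> real"

definition smooth_tensors ::
  "('i, 'm, 'e::real_normed_vector) manifold \<Rightarrow> ('i, 'e) contact_data \<Rightarrow> bool" where
  "smooth_tensors M S \<longleftrightarrow>
     (\<forall>i\<in>charts M. let E = model M; U = chart_image M i in
        smooth_field E U (reeb S i) \<and>
        (\<forall>x\<in>U. linear_on_space E (endo S i x) \<and> linear_on_space E (form S i x) \<and>
           (\<forall>v\<in>E. linear_on_space E (metric S i x v) \<and> linear_on_space E (\<lambda>u. metric S i x u v))) \<and>
        (\<forall>v\<in>E. smooth_field E U (\<lambda>x. endo S i x v) \<and> smooth_on E U (\<lambda>x. form S i x v) \<and>
           (\<forall>w\<in>E. smooth_on E U (\<lambda>x. metric S i x v w)))) \<and>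
     (\<forall>i\<in>charts M. \<forall>j\<in>charts M. \<forall>p\<in>chart_dom M i \<inter> chart_dom M j.
        let x = chart_map M i p; y = chart_map M j p; T = change_of_chart M i j p in
          reeb S j y = T (reeb S i x) \<and>
          (\<forall>v\<in>model M. endo S j y (T v) = T (endo S i x v) \<and> form S j y (T v) = form S i x v \<and>
             (\<forall>w\<in>model M. metric S j y (T v) (T w) = metric S i x v w)))"

definition pseudo_Riemannian ::
  "('i, 'm, 'e::real_normed_vector) manifold \<Rightarrow> ('i, 'e) contact_data \<Rightarrow> bool" where
  "pseudo_Riemannian M S \<longleftrightarrow>
     (\<forall>i\<in>charts M. \<forall>x\<in>chart_image M i.
        (\<forall>v\<in>model M. \<forall>w\<in>model M. metric S i x v w = metric S i x w v) \<and>
        (\<forall>v\<in>model M. (\<forall>w\<in>model M. metric S i x v w = 0) \<longrightarrow> v = 0))"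

definition almost_contact_metric ::
  "('i, 'm, 'e::real_normed_vector) manifold \<Rightarrow> ('i, 'e) contact_data \<Rightarrow> bool" where
  "almost_contact_metric M S \<longleftrightarrow>
     smooth_tensors M S \<and> pseudo_Riemannian M S \<and>
     (\<forall>i\<in>charts M. \<forall>x\<in>chart_image M i.
        let \<phi> = endo S i x; \<xi> = reeb S i x; \<eta> = form S i x; g = metric S i x in
          \<eta> \<xi> = 1 \<and> \<phi> \<xi> = 0 \<and>
          (\<forall>v\<in>model M. \<eta> (\<phi> v) = 0 \<and> \<phi> (\<phi> v) = - v + \<eta> v *\<^sub>R \<xi>) \<and>
          (\<forall>v\<in>model M. \<forall>w\<in>model M. g (\<phi> v) (\<phi> w) = g v w - \<eta> v * \<eta> w)) \<and>
     (\<forall>i\<in>charts M. \<forall>V. smooth_field (model M) (chart_image M i) V \<longrightarrow>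
        (\<forall>x\<in>chart_image M i. ext_deriv (form S i) (reeb S i) V x = 0))"

definition contact_metric ::
  "('i, 'm, 'e::real_normed_vector) manifold \<Rightarrow> ('i, 'e) contact_data \<Rightarrow> bool" where
  "contact_metric M S \<longleftrightarrow>
     almost_contact_metric M S \<and>
     (\<forall>i\<in>charts M. \<forall>V W. smooth_field (model M) (chart_image M i) V \<and>
        smooth_field (model M) (chart_image M i) W \<longrightarrow>
        (\<forall>x\<in>chart_image M i.
           metric S i x (V x) (endo S i x (W x)) = ext_deriv (form S i) V W x))"

definition K_contact ::
  "('i, 'm, 'e::real_normed_vector) manifold \<Rightarrow> ('i, 'e) contact_data \<Rightarrow> bool" where
  "K_contact M S \<longleftrightarrow>
     (\<forall>i\<in>charts M. \<forall>V W. smooth_field (model M) (chart_image M i) V \<and>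
        smooth_field (model M) (chart_image M i) W \<longrightarrow>
        (\<forall>x\<in>chart_image M i. lie_deriv_metric (reeb S i) (metric S i) V W x = 0))"

definition almost_normal ::
  "('i, 'm, 'e::real_normed_vector) manifold \<Rightarrow> ('i, 'e) contact_data \<Rightarrow> bool" where
  "almost_normal M S \<longleftrightarrow>
     (\<forall>i\<in>charts M. \<forall>V W. smooth_field (model M) (chart_image M i) V \<and>
        smooth_field (model M) (chart_image M i) W \<longrightarrow>
        (\<forall>x\<in>chart_image M i.
           nijenhuis (endo S i) V W x
             + (2 * ext_deriv (form S i) (\<lambda>y. endo S i y (V y)) (\<lambda>y. endo S i y (W y)) x) *\<^sub>R reeb S i x
           = 0))"


section \<open>The intrinsic metric connection\<close>

text \<open>Sections over the domain of chart \<open>i\<close> of the distribution \<open>D = ker \<eta>\<close>.\<close>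

definition D_section ::
  "('i, 'm, 'e::real_normed_vector) manifold \<Rightarrow> ('i, 'e) contact_data \<Rightarrow> 'i \<Rightarrow> ('e \<Rightarrow> 'e) \<Rightarrow> bool" where
  "D_section M S i V \<longleftrightarrow>
     smooth_field (model M) (chart_image M i) V \<and> (\<forall>x\<in>chart_image M i. form S i x (V x) = 0)"

text \<open>The projection onto \<open>D\<close> along \<open>\<xi>\<close>.\<close>

definition proj_D :: "('i, 'e::real_vector) contact_data \<Rightarrow> 'i \<Rightarrow> 'e \<Rightarrow> 'e \<Rightarrow> 'e" where
  "proj_D S i x v = v - form S i x v *\<^sub>R reeb S i x"

type_synonym ('i, 'e) connection = "'i \<Rightarrow> ('e \<Rightarrow> 'e) \<Rightarrow> ('e \<Rightarrow> 'e) \<Rightarrow> 'e \<Rightarrow> 'e"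

text \<open>
  \<open>nab i\<close> is the restriction of the connection to sections of \<open>D\<close> over the domain of chart \<open>i\<close>. The
  last two conditions determine it there (Koszul formula), so the operators belonging to different
  charts automatically agree on overlaps.
\<close>

definition intrinsic_metric_connection ::
  "('i, 'm, 'e::real_normed_vector) manifold \<Rightarrow> ('i, 'e) contact_data \<Rightarrow>
   ('i, 'e) connection \<Rightarrow> bool" where
  "intrinsic_metric_connection M S nab \<longleftrightarrow>
     (\<forall>i\<in>charts M. \<forall>X Y Z f. D_section M S i X \<and> D_section M S i Y \<and> D_section M S i Z \<and>
        smooth_on (model M) (chart_image M i) (f :: 'e \<Rightarrow> real) \<longrightarrow>
        D_section M S i (nab i X Y) \<and>
        (\<forall>x\<in>chart_image M i.
           nab i (\<lambda>y. X y + Z y) Y x = nab i X Y x + nab i Z Y x \<and>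
           nab i (\<lambda>y. f y *\<^sub>R X y) Y x = f x *\<^sub>R nab i X Y x \<and>
           nab i X (\<lambda>y. Y y + Z y) x = nab i X Y x + nab i X Z x \<and>
           nab i X (\<lambda>y. f y *\<^sub>R Y y) x = dir_deriv f x (X x) *\<^sub>R Y x + f x *\<^sub>R nab i X Y x \<and>
           dir_deriv (\<lambda>y. metric S i y (X y) (Y y)) x (Z x)
             = metric S i x (nab i Z X x) (Y x) + metric S i x (X x) (nab i Z Y x) \<and>
           nab i X Y x - nab i Y X x = proj_D S i x (lie_bracket X Y x)))"


section \<open>Adapted charts and the Schouten curvature tensor\<close>

text \<open>
  From here on \<open>k\<close> labels the distinguished coordinate \<open>x\<^sup>n\<close> (\<open>\<xi> = \<partial>\<^sub>n\<close>); the indices \<open>a, b, c, d\<close> range over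
  the other elements of \<open>'n\<close>.
\<close>

definition adapted ::
  "('i, 'm, real^'n) manifold \<Rightarrow> ('i, real^'n) contact_data \<Rightarrow> 'n::finite \<Rightarrow> 'i \<Rightarrow> bool" where
  "adapted M S k i \<longleftrightarrow> i \<in> charts M \<and> (\<forall>x\<in>chart_image M i. reeb S i x = axis k 1)"

text \<open>The frame \<open>e\<^sub>a = \<partial>\<^sub>a - \<Gamma>\<^sup>n\<^sub>a \<partial>\<^sub>n\<close> of \<open>D\<close>; by \<open>\<eta> = dx\<^sup>n + \<Gamma>\<^sup>n\<^sub>a dx\<^sup>a\<close> its coefficient is
  \<open>\<Gamma>\<^sup>n\<^sub>a = \<eta>(\<partial>\<^sub>a)\<close>.\<close>

definition D_frame :: "('i, real^'n) contact_data \<Rightarrow> 'n::finite \<Rightarrow> 'i \<Rightarrow> 'n \<Rightarrow> real^'n \<Rightarrow> real^'n" where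
  "D_frame S k i a x = axis a 1 - form S i x (axis a 1) *\<^sub>R axis k 1"

text \<open>\<open>christoffel \<dots> c a b\<close> is \<open>\<Gamma>\<^sup>c\<^sub>a\<^sub>b\<close>, defined by \<open>\<nabla>\<^bsub>e\<^sub>a\<^esub> e\<^sub>b = \<Gamma>\<^sup>c\<^sub>a\<^sub>b e\<^sub>c\<close>: for \<open>c \<noteq> k\<close> the coefficient
  of \<open>e\<^sub>c\<close> in a vector of \<open>D\<close> is its coordinate component with index \<open>c\<close>.\<close>

definition christoffel ::
  "('i, real^'n) contact_data \<Rightarrow> ('i, real^'n) connection \<Rightarrow>
   'n::finite \<Rightarrow> 'i \<Rightarrow> 'n \<Rightarrow> 'n \<Rightarrow> 'n \<Rightarrow> real^'n \<Rightarrow> real" where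
  "christoffel S nab k i c a b x = nab i (D_frame S k i a) (D_frame S k i b) x $ c"

text \<open>\<open>schouten_curvature \<dots> d a b c\<close> is \<open>R\<^sup>d\<^sub>a\<^sub>b\<^sub>c\<close>, where \<open>R(e\<^sub>a, e\<^sub>b) e\<^sub>c = R\<^sup>d\<^sub>a\<^sub>b\<^sub>c e\<^sub>d\<close>.\<close>

definition schouten_curvature ::
  "('i, real^'n) contact_data \<Rightarrow> ('i, real^'n) connection \<Rightarrow>
   'n::finite \<Rightarrow> 'i \<Rightarrow> 'n \<Rightarrow> 'n \<Rightarrow> 'n \<Rightarrow> 'n \<Rightarrow> real^'n \<Rightarrow> real" where
  "schouten_curvature S nab k i d a b c x =
     (let \<Gamma> = christoffel S nab k i in
        dir_deriv (\<Gamma> d b c) x (D_frame S k i a x) - dir_deriv (\<Gamma> d a c) x (D_frame S k i b x)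
        + (\<Sum>e\<in>-{k}. \<Gamma> d a e x * \<Gamma> e b c x - \<Gamma> d b e x * \<Gamma> e a c x))"

definition zero_curvature ::
  "('i, 'm, real^'n) manifold \<Rightarrow> ('i, real^'n) contact_data \<Rightarrow>
   ('i, real^'n) connection \<Rightarrow> 'n::finite \<Rightarrow> bool" where
  "zero_curvature M S nab k \<longleftrightarrow>
     (\<forall>i x. adapted M S k i \<and> x \<in> chart_image M i \<longrightarrow>
        (\<forall>a\<in>-{k}. \<forall>b\<in>-{k}. \<forall>c\<in>-{k}. \<forall>d\<in>-{k}. schouten_curvature S nab k i d a b c x = 0))"


section \<open>The total space of the distribution and the prolonged structure\<close>

text \<open>
  Points of the total space are pairs \<open>(p, v)\<close> with \<open>v \<in> D\<^sub>p\<close>. An adapted chart \<open>i\<close> of the base yields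
  the chart \<open>(x\<^sup>\<alpha>, x\<^sup>n\<^sup>+\<^sup>a)\<close>; the \<open>x\<^sup>n\<^sup>+\<^sup>a\<close> are stored in a vector whose unused component \<open>k\<close> is zero, and
  the coefficient of \<open>e\<^sub>a\<close> in \<open>v\<close> is \<open>v i $ a\<close>. In these charts the projection to the base is \<open>fst\<close>.
\<close>

definition total_points ::
  "('i, 'm, real^'n) manifold \<Rightarrow> ('i, real^'n) contact_data \<Rightarrow> ('m \<times> ('i \<Rightarrow> real^'n::finite)) set" where
  "total_points M S = {(p, v). p \<in> points M \<and> v \<in> tangent_space M p \<and>
     (\<forall>i\<in>charts M. p \<in> chart_dom M i \<longrightarrow> form S i (chart_map M i p) (v i) = 0)}"

definition total_space ::
  "('i, 'm, real^'n) manifold \<Rightarrow> ('i, real^'n) contact_data \<Rightarrow> 'n::finite \<Rightarrow>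
   ('i, 'm \<times> ('i \<Rightarrow> real^'n), (real^'n) \<times> (real^'n)) manifold" where
  "total_space M S k = \<lparr>
     model = {(x, y). y $ k = 0},
     charts = {i. adapted M S k i},
     chart_dom = (\<lambda>i. {(p, v) \<in> total_points M S. p \<in> chart_dom M i}),
     chart_map = (\<lambda>i (p, v). (chart_map M i p, \<chi> a. if a = k then 0 else v i $ a)) \<rparr>"

text \<open>
  The frame \<open>\<epsilon>\<^sub>a = \<partial>\<^sub>a - \<Gamma>\<^sup>n\<^sub>a \<partial>\<^sub>n - \<Gamma>\<^sup>b\<^sub>a\<^sub>c x\<^sup>n\<^sup>+\<^sup>c \<partial>\<^sub>n\<^sub>+\<^sub>b\<close> (\<open>hor\<close>), \<open>\<partial>\<^sub>n\<^sub>+\<^sub>a\<close> (\<open>ver\<close>), \<open>u = \<partial>\<^sub>n\<close>. This is the frame of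
  the \<open>N\<close>-prolonged connection for \<open>N = 0\<close>, as is the case for K-contact structures.
\<close>

definition hor ::
  "('i, real^'n) contact_data \<Rightarrow> ('i, real^'n) connection \<Rightarrow>
   'n::finite \<Rightarrow> 'i \<Rightarrow> 'n \<Rightarrow> (real^'n) \<times> (real^'n) \<Rightarrow> (real^'n) \<times> (real^'n)" where
  "hor S nab k i a = (\<lambda>(x, y). (D_frame S k i a x,
     - (\<Sum>b\<in>-{k}. \<Sum>c\<in>-{k}. (christoffel S nab k i b a c x * y $ c) *\<^sub>R axis b 1)))"

definition ver :: "'n::finite \<Rightarrow> (real^'n) \<times> (real^'n)" where
  "ver a = (0, axis a 1)"

definition u_field :: "'n::finite \<Rightarrow> (real^'n) \<times> (real^'n)" where
  "u_field k = (axis k 1, 0)"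

text \<open>Coefficients of a tangent vector of the total space with respect to \<open>\<epsilon>\<^sub>a\<close> and \<open>\<partial>\<^sub>n\<^sub>+\<^sub>a\<close>; the
  coefficient of \<open>u\<close> is \<open>\<lambda>\<close>.\<close>

definition hor_coeff :: "'n::finite \<Rightarrow> (real^'n) \<times> (real^'n) \<Rightarrow> real" where
  "hor_coeff a w = fst w $ a"

definition ver_coeff ::
  "('i, real^'n) contact_data \<Rightarrow> ('i, real^'n) connection \<Rightarrow>
   'n::finite \<Rightarrow> 'i \<Rightarrow> 'n \<Rightarrow> (real^'n) \<times> (real^'n) \<Rightarrow> (real^'n) \<times> (real^'n) \<Rightarrow> real" where
  "ver_coeff S nab k i b z w =
     snd w $ b + (\<Sum>a\<in>-{k}. \<Sum>c\<in>-{k}. christoffel S nab k i b a c (fst z) * fst w $ a * snd z $ c)"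

definition prolonged ::
  "('i, real^'n) contact_data \<Rightarrow> ('i, real^'n) connection \<Rightarrow>
   'n::finite \<Rightarrow> ('i, (real^'n) \<times> (real^'n)) contact_data" where
  "prolonged S nab k = \<lparr>
     endo = (\<lambda>i z w. (\<Sum>a\<in>-{k}. hor_coeff a w *\<^sub>R ver a)
                       - (\<Sum>a\<in>-{k}. ver_coeff S nab k i a z w *\<^sub>R hor S nab k i a z)),
     reeb = (\<lambda>i z. u_field k),
     form = (\<lambda>i z w. form S i (fst z) (fst w)),
     metric = (\<lambda>i z w w'.
       (\<Sum>a\<in>-{k}. \<Sum>b\<in>-{k}.
          (hor_coeff a w * hor_coeff b w' + ver_coeff S nab k i a z w * ver_coeff S nab k i b z w')
          * metric S i (fst z) (D_frame S k i a (fst z)) (D_frame S k i b (fst z)))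
       + form S i (fst z) (fst w) * form S i (fst z) (fst w')) \<rparr>"

text \<open>The two lemmas below recover the description of the prolonged structure on the frame.\<close>

lemma frame_coeffs:
  fixes S :: "('i, real^'n::finite) contact_data"
  assumes "a \<noteq> k" "b \<noteq> k"
  shows "hor_coeff b (hor S nab k i a z) = (if a = b then 1 else 0)"
    and "ver_coeff S nab k i b z (hor S nab k i a z) = 0"
    and "hor_coeff b (ver a) = 0"
    and "ver_coeff S nab k i b z (ver a) = (if a = b then 1 else 0)"
    and "hor_coeff b (u_field k) = 0"
    and "ver_coeff S nab k i b z (u_field k) = 0"
proof -
  obtain x y where z: "z = (x, y)" by (cases z)
  have e: "D_frame S k i a x $ c = (if a = c then 1 else 0)" if "c \<noteq> k" for c
    using that by (simp add: D_frame_def axis_def)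
  show "hor_coeff b (hor S nab k i a z) = (if a = b then 1 else 0)"
    using e assms by (simp add: hor_coeff_def hor_def z)
  have 1: "snd (hor S nab k i a z) $ b = - (\<Sum>c\<in>-{k}. christoffel S nab k i b a c x * y $ c)"
  proof -
    have "(\<Sum>b'\<in>-{k}. \<Sum>c\<in>-{k}. (christoffel S nab k i b' a c x * y $ c) * axis b' 1 $ b)
        = (\<Sum>b'\<in>-{k}. if b' = b then \<Sum>c\<in>-{k}. christoffel S nab k i b' a c x * y $ c else 0)"
      by (rule sum.cong) (auto simp: axis_def)
    then have "snd (hor S nab k i a z) $ b =
        - (\<Sum>b'\<in>-{k}. if b' = b then \<Sum>c\<in>-{k}. christoffel S nab k i b' a c x * y $ c else 0)"
      by (simp add: hor_def z)
    then show ?thesis using assms by simp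
  qed
  have 2: "(\<Sum>a'\<in>-{k}. \<Sum>c\<in>-{k}. christoffel S nab k i b a' c x * fst (hor S nab k i a z) $ a' * y $ c)
      = (\<Sum>a'\<in>-{k}. if a' = a then \<Sum>c\<in>-{k}. christoffel S nab k i b a' c x * y $ c else 0)"
    by (rule sum.cong) (auto simp: hor_def z e)
  show "ver_coeff S nab k i b z (hor S nab k i a z) = 0"
    using 1 2 assms by (simp add: ver_coeff_def z)
qed (use assms in \<open>auto simp: hor_coeff_def ver_coeff_def ver_def u_field_def axis_def\<close>)

lemma prolonged_on_frame:
  fixes M :: "('i, 'm, real^'n::finite) manifold" and nab :: "('i, real^'n) connection"
  assumes S: "almost_contact_metric M S" "model M = UNIV"
    and i: "adapted M S k i" and z: "fst z \<in> chart_image M i"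
    and ab: "a \<noteq> k" "b \<noteq> k"
  defines "P \<equiv> prolonged S nab k"
    and "g \<equiv> metric S i (fst z) (D_frame S k i a (fst z)) (D_frame S k i b (fst z))"
  shows "endo P i z (hor S nab k i a z) = ver a"
    and "endo P i z (ver a) = - hor S nab k i a z"
    and "endo P i z (u_field k) = 0"
    and "form P i z (hor S nab k i a z) = 0"
    and "form P i z (ver a) = 0"
    and "form P i z (u_field k) = 1"
    and "metric P i z (hor S nab k i a z) (hor S nab k i b z) = g"
    and "metric P i z (ver a) (ver b) = g"
    and "metric P i z (hor S nab k i a z) (ver b) = 0"
    and "metric P i z (hor S nab k i a z) (u_field k) = 0"
    and "metric P i z (u_field k) (ver b) = 0"
    and "metric P i z (u_field k) (u_field k) = 1"
proof -
  have iM: "i \<in> charts M" and r: "reeb S i (fst z) = axis k 1"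
    using i z by (auto simp: adapted_def)
  have lin: "linear (form S i (fst z))"
    using S iM z unfolding almost_contact_metric_def smooth_tensors_def Let_def linear_on_space_def
    by (auto intro!: linearI)
  have k1: "form S i (fst z) (axis k 1) = 1"
    using S iM z r unfolding almost_contact_metric_def Let_def by metis
  have fh: "form S i (fst z) (fst (hor S nab k i a z)) = 0" for a
    by (simp add: hor_def case_prod_beta D_frame_def linear_diff[OF lin] linear_scale[OF lin] k1)
  have fv: "form S i (fst z) (fst (ver a)) = 0" for a :: 'n
    by (simp add: ver_def linear_0[OF lin])
  have fu: "form S i (fst z) (fst (u_field k)) = 1"
    by (simp add: u_field_def k1)
  note simps = P_def g_def prolonged_def fh fv fu frame_coeffs[where k = k]
  have d: "(\<Sum>c\<in>-{k}. (if a = c then 1 else 0) *\<^sub>R h c) = h a" if "a \<noteq> k"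
    for a :: 'n and h :: "'n \<Rightarrow> (real^'n) \<times> (real^'n)"
  proof -
    have "(\<Sum>c\<in>-{k}. (if a = c then 1 else 0) *\<^sub>R h c) = (\<Sum>c\<in>-{k}. if a = c then h c else 0)"
      by (rule sum.cong) auto
    then show ?thesis using that by simp
  qed
  have d2: "(\<Sum>c\<in>-{k}. \<Sum>c'\<in>-{k}. ((if a = c then 1 else 0) * (if b = c' then 1 else 0)) * h c c') = h a b"
    for h :: "'n \<Rightarrow> 'n \<Rightarrow> real"
  proof -
    have "(\<Sum>c'\<in>-{k}. ((if a = c then 1 else 0) * (if b = c' then 1 else 0)) * h c c')
        = (\<Sum>c'\<in>-{k}. if b = c' then (if a = c then h c c' else 0) else 0)" for c
      by (rule sum.cong) auto
    then show ?thesis using ab by simp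
  qed
  show "endo P i z (hor S nab k i a z) = ver a" "endo P i z (ver a) = - hor S nab k i a z"
    "endo P i z (u_field k) = 0"
    "form P i z (hor S nab k i a z) = 0" "form P i z (ver a) = 0" "form P i z (u_field k) = 1"
    "metric P i z (hor S nab k i a z) (hor S nab k i b z) = g"
    "metric P i z (ver a) (ver b) = g"
    "metric P i z (hor S nab k i a z) (ver b) = 0"
    "metric P i z (hor S nab k i a z) (u_field k) = 0"
    "metric P i z (u_field k) (ver b) = 0"
    "metric P i z (u_field k) (u_field k) = 1"
    using ab d2[of "\<lambda>c c'. metric S i (fst z) (D_frame S k i c (fst z)) (D_frame S k i c' (fst z))"]
    by (simp_all add: simps d frame_coeffs(5,6)[where a = a and k = k])
qed

end

theory Submission
  imports Defs
begin

text \<open>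
  Almost normality is the vanishing of the component of the torsion \<open>N\<^sub>J\<close> along \<open>ker \<lambda>\<close>: since
  \<open>\<lambda> \<circ> J = 0\<close>, the term \<open>2 d\<lambda>(JX, JY)\<close> equals \<open>- \<lambda>(N\<^sub>J(X, Y))\<close>. The torsion is a tensor, so it suffices
  to evaluate it on the frame \<open>\<epsilon>\<^sub>a\<close>, \<open>\<partial>\<^sub>n\<^sub>+\<^sub>a\<close>, \<open>u\<close>. There \<open>[\<epsilon>\<^sub>a, \<partial>\<^sub>n\<^sub>+\<^sub>b] = \<Gamma>\<^sup>c\<^sub>a\<^sub>b \<partial>\<^sub>n\<^sub>+\<^sub>c\<close>, which is symmetric
  in \<open>a\<close> and \<open>b\<close>, while \<open>[\<epsilon>\<^sub>a, \<epsilon>\<^sub>b]\<close> is \<open>- R\<^sup>d\<^sub>a\<^sub>b\<^sub>c x\<^sup>n\<^sup>+\<^sup>c \<partial>\<^sub>n\<^sub>+\<^sub>d\<close> up to a multiple of \<open>u\<close>. As the Reeb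
  field is Killing, the Christoffel symbols do not depend on \<open>x\<^sup>n\<close>, so \<open>[u, \<epsilon>\<^sub>a] = 0\<close>. Hence the only
  obstruction is \<open>R\<^sup>d\<^sub>a\<^sub>b\<^sub>c x\<^sup>n\<^sup>+\<^sup>c\<close>, and the fibre coordinates \<open>x\<^sup>n\<^sup>+\<^sup>c\<close> are arbitrary.
\<close>

section \<open>Directional derivatives\<close>

text \<open>A line through a point of \<open>S\<close> with direction in \<open>E\<close> never
  leaves \<open>E\<close>, so relative openness is enough. This makes \<open>dir_deriv\<close> along
  \<open>E\<close> local on \<open>S\<close>.\<close>

lemma eventually_line_in:
  fixes E :: "'e::real_normed_vector set"
  assumes "subspace E" "openin (top_of_set E) S" "x \<in> S" "v \<in> E"
  shows "\<forall>\<^sub>F t in nhds (0::real). x + t *\<^sub>R v \<in> S"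
proof -
  obtain T where T: "open T" "S = E \<inter> T"
    using assms(2) by (auto simp: openin_open)
  have "((\<lambda>t::real. x + t *\<^sub>R v) \<longlongrightarrow> x + 0 *\<^sub>R v) (nhds 0)"
    by (intro tendsto_add tendsto_const tendsto_scaleR filterlim_ident)
  then have "\<forall>\<^sub>F t in nhds (0::real). x + t *\<^sub>R v \<in> T"
    by (rule topological_tendstoD) (use T assms(3) in auto)
  then show ?thesis
    by eventually_elim (use T assms in \<open>auto intro: subspace_add subspace_scale\<close>)
qed

lemma dir_deriv_cong:
  assumes "subspace E" "openin (top_of_set E) S" "x \<in> S" "v \<in> E" "\<And>y. y \<in> S \<Longrightarrow> f y = g y"
  shows "dir_deriv f x v = dir_deriv g x v"
  unfolding dir_deriv_def
proof (rule vector_derivative_cong_eq)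
  show "\<forall>\<^sub>F t in nhds 0. t \<in> UNIV \<longrightarrow> f (x + t *\<^sub>R v) = g (x + t *\<^sub>R v)"
    using eventually_line_in[OF assms(1-4)] by eventually_elim (simp add: assms(5))
qed auto

text \<open>A derivative within \<open>S\<close> is pinned down only in directions of
  \<open>E\<close>; there the chain rule along the line, which stays in \<open>S\<close> for small
  times, recovers it.\<close>

lemma dir_deriv_eq:
  assumes "subspace E" "openin (top_of_set E) S" "x \<in> S" "v \<in> E"
    and f: "(f has_derivative f') (at x within S)"
  shows "dir_deriv f x v = f' v"
proof -
  obtain A where A: "open A" "(0::real) \<in> A" "\<And>t. t \<in> A \<Longrightarrow> x + t *\<^sub>R v \<in> S"
    using eventually_line_in[OF assms(1-4)] by (auto simp: eventually_nhds)
  have "((\<lambda>t::real. x + t *\<^sub>R v) has_derivative (\<lambda>t. t *\<^sub>R v)) (at 0 within A)"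
    by (auto intro!: derivative_eq_intros)
  moreover have "(f has_derivative f') (at (x + 0 *\<^sub>R v) within (\<lambda>t. x + t *\<^sub>R v) ` A)"
    by (rule has_derivative_subset[where s = S]) (use f A in auto)
  ultimately have "(f \<circ> (\<lambda>t. x + t *\<^sub>R v) has_derivative f' \<circ> (\<lambda>t. t *\<^sub>R v)) (at 0 within A)"
    by (rule diff_chain_within)
  then have "((\<lambda>t. f (x + t *\<^sub>R v)) has_derivative (\<lambda>t. f' (t *\<^sub>R v))) (at 0)"
    unfolding o_def at_within_open[OF A(2,1)] .
  then have "((\<lambda>t. f (x + t *\<^sub>R v)) has_vector_derivative f' v) (at 0)"
    unfolding has_vector_derivative_def linear_scale[OF has_derivative_linear[OF f]] .
  then show ?thesis
    unfolding dir_deriv_def by (rule vector_derivative_at)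
qed

lemma dir_deriv_at:
  assumes "(f has_derivative f') (at x)"
  shows "dir_deriv f x v = f' v"
  using dir_deriv_eq[of UNIV UNIV x v f f'] assms by simp

lemma has_derivative_dir_deriv:
  assumes "f differentiable (at x)"
  shows "(f has_derivative dir_deriv f x) (at x)"
proof -
  obtain f' where f': "(f has_derivative f') (at x)"
    using assms by (auto simp: differentiable_def)
  then have "dir_deriv f x = f'"
    using dir_deriv_at by blast
  then show ?thesis using f' by simp
qed

lemma dir_deriv_const [simp]: "dir_deriv (\<lambda>y. c) x v = 0"
  by (simp add: dir_deriv_def)

lemma dir_deriv_cong_open:
  assumes "open S" "x \<in> S" "\<And>y. y \<in> S \<Longrightarrow> f y = g y"
  shows "dir_deriv f x v = dir_deriv g x v"
  by (rule dir_deriv_cong[of UNIV S]) (use assms in auto)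

lemma lie_bracket_const: "lie_bracket (\<lambda>_. v) (\<lambda>_. w) x = 0"
  by (simp add: lie_bracket_def)

lemma lie_bracket_swap: "lie_bracket W V x = - lie_bracket V W x"
  by (simp add: lie_bracket_def)

lemma lie_bracket_minus:
  assumes "V differentiable (at x)" "W differentiable (at x)"
  shows "lie_bracket (\<lambda>y. - V y) W x = - lie_bracket V W x"
proof -
  have "dir_deriv (\<lambda>y. - V y) x v = - dir_deriv V x v" for v
    by (rule dir_deriv_at[OF has_derivative_minus[OF has_derivative_dir_deriv[OF assms(1)]]])
  moreover have "dir_deriv W x (- v) = - dir_deriv W x v" for v
    by (rule linear_neg[OF has_derivative_linear[OF has_derivative_dir_deriv[OF assms(2)]]])
  ultimately show ?thesis
    by (simp add: lie_bracket_def)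
qed

section \<open>The torsion of an endomorphism field as a pointwise bilinear map\<close>

lemma dir_deriv_linear_family:
  fixes J :: "'e::euclidean_space \<Rightarrow> 'e \<Rightarrow> 'f::real_normed_vector"
  assumes E: "subspace E" "openin (top_of_set E) S" "z \<in> S" "u \<in> E"
    and lin: "\<And>y. y \<in> S \<Longrightarrow> linear (J y)"
    and J: "\<And>w. (\<lambda>y. J y w) differentiable (at z within S)"
    and W: "W differentiable (at z within S)"
  shows "dir_deriv (\<lambda>y. J y (W y)) z u
    = dir_deriv (\<lambda>y. J y (W z)) z u + J z (dir_deriv W z u)"
proof -
  obtain W' where W': "(W has_derivative W') (at z within S)"
    using W by (auto simp: differentiable_def)
  obtain J' where J': "\<And>w. ((\<lambda>y. J y w) has_derivative J' w) (at z within S)"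
    using J by (auto simp: differentiable_def) metis
  \<comment> \<open>Expanding \<open>w\<close> in an orthonormal basis turns the product rule into
    finitely many products. \<open>fam\<close> is used twice, for \<open>W\<close> and for the
    constant field \<open>W z\<close>.\<close>
  have exp: "J y w = (\<Sum>b\<in>Basis. (w \<bullet> b) *\<^sub>R J y b)" if "y \<in> S" for y w
    by (subst euclidean_representation[of w, symmetric])
      (simp add: linear_sum[OF lin[OF that]] linear_scale[OF lin[OF that]])
  have fam: "((\<lambda>y. \<Sum>b\<in>Basis. (W y \<bullet> b) *\<^sub>R J y b) has_derivative
      (\<lambda>u. \<Sum>b\<in>Basis. (W z \<bullet> b) *\<^sub>R J' b u + (W' u \<bullet> b) *\<^sub>R J z b)) (at z within S)"
    if "(W has_derivative W') (at z within S)" for W W'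
    by (intro has_derivative_sum has_derivative_scaleR has_derivative_inner_left that J')
  have "dir_deriv (\<lambda>y. J y (W y)) z u
      = dir_deriv (\<lambda>y. \<Sum>b\<in>Basis. (W y \<bullet> b) *\<^sub>R J y b) z u"
    by (rule dir_deriv_cong[OF E]) (rule exp)
  also have "\<dots> = (\<Sum>b\<in>Basis. (W z \<bullet> b) *\<^sub>R J' b u) + J z (W' u)"
    by (subst dir_deriv_eq[OF E fam[OF W']]) (simp add: exp[OF E(3), of "W' u"] sum.distrib)
  also have "(\<Sum>b\<in>Basis. (W z \<bullet> b) *\<^sub>R J' b u)
      = dir_deriv (\<lambda>y. \<Sum>b\<in>Basis. (W z \<bullet> b) *\<^sub>R J y b) z u"
    by (subst dir_deriv_eq[OF E fam[OF has_derivative_const]]) simp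
  also have "\<dots> = dir_deriv (\<lambda>y. J y (W z)) z u"
    by (rule dir_deriv_cong[OF E]) (rule exp[symmetric])
  finally show ?thesis
    using dir_deriv_eq[OF E W'] by simp
qed

text \<open>This is the torsion evaluated on the constant extensions of \<open>v\<close> and
  \<open>w\<close>: their bracket vanishes, and only derivatives of \<open>J\<close> remain.\<close>

definition nijenhuis_tensor ::
    "('e::real_normed_vector \<Rightarrow> 'e \<Rightarrow> 'e) \<Rightarrow> 'e \<Rightarrow> 'e \<Rightarrow> 'e \<Rightarrow> 'e" where
  "nijenhuis_tensor J z v w =
     (let D = (\<lambda>u w. dir_deriv (\<lambda>y. J y w) z u) in
      D (J z v) w - D (J z w) v + J z (D w v) - J z (D v w))"

text \<open>All derivatives of the arguments cancel, so the torsion of an endomorphism field is a tensor.\<close>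

lemma nijenhuis_eq_tensor:
  fixes J :: "'e::euclidean_space \<Rightarrow> 'e \<Rightarrow> 'e"
  assumes E: "subspace E" "openin (top_of_set E) S" "z \<in> S"
    and lin: "\<And>y. y \<in> S \<Longrightarrow> linear (J y)"
    and J: "\<And>w. (\<lambda>y. J y w) differentiable (at z within S)"
    and JE: "\<And>v. v \<in> E \<Longrightarrow> J z v \<in> E"
    and V: "V differentiable (at z within S)" "V z \<in> E"
    and W: "W differentiable (at z within S)" "W z \<in> E"
  shows "nijenhuis J V W z = nijenhuis_tensor J z (V z) (W z)"
proof -
  note d = dir_deriv_linear_family[OF E _ lin J V(1)] dir_deriv_linear_family[OF E _ lin J W(1)]
  note l = linear_add[OF lin[OF E(3)]] linear_diff[OF lin[OF E(3)]]
  show ?thesis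
    by (simp add: nijenhuis_def nijenhuis_tensor_def lie_bracket_def d V(2) W(2) JE l Let_def)
qed

lemma linear_dir_deriv_family:
  assumes "\<And>y. linear (J y)" "\<And>w. (\<lambda>y. J y w) differentiable (at z)"
  shows "linear (\<lambda>u. dir_deriv (\<lambda>y. J y w) z u)" "linear (\<lambda>w. dir_deriv (\<lambda>y. J y w) z u)"
proof -
  have h: "((\<lambda>y. J y w) has_derivative dir_deriv (\<lambda>y. J y w) z) (at z)" for w
    by (rule has_derivative_dir_deriv) (rule assms)
  then show "linear (\<lambda>u. dir_deriv (\<lambda>y. J y w) z u)"
    using has_derivative_linear by blast
  show "linear (\<lambda>w. dir_deriv (\<lambda>y. J y w) z u)"
  proof (rule linearI)
    fix v w r
    show "dir_deriv (\<lambda>y. J y (v + w)) z u = dir_deriv (\<lambda>y. J y v) z u + dir_deriv (\<lambda>y. J y w) z u"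
      using dir_deriv_at[OF has_derivative_add[OF h h]] by (simp add: linear_add[OF assms(1)])
    show "dir_deriv (\<lambda>y. J y (r *\<^sub>R w)) z u = r *\<^sub>R dir_deriv (\<lambda>y. J y w) z u"
      using dir_deriv_at[OF has_derivative_scaleR_right[OF h]] by (simp add: linear_scale[OF assms(1)])
  qed
qed

lemma nijenhuis_tensor_swap:
  assumes "linear (J z)"
  shows "nijenhuis_tensor J z w v = - nijenhuis_tensor J z v w"
  by (simp add: nijenhuis_tensor_def Let_def)

lemma linear_nijenhuis_tensor:
  assumes "\<And>y. linear (J y)" "\<And>w. (\<lambda>y. J y w) differentiable (at z)"
  shows "linear (\<lambda>v. nijenhuis_tensor J z v w)"
  unfolding nijenhuis_tensor_def Let_def
  by (intro linear_compose_add linear_compose_sub linear_dir_deriv_family assms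
      linear_compose[of "J z" "\<lambda>v. dir_deriv (\<lambda>y. J y w) z v", unfolded o_def]
      linear_compose[of _ "J z", unfolded o_def])

text \<open>Linearity in the first slot and antisymmetry spread the vanishing from \<open>B\<close>
  to its span, one argument at a time. The map \<open>p\<close> will be the projection
  \<open>proj z\<close>, the only component that has to vanish.\<close>

lemma nijenhuis_tensor_span_0:
  assumes J: "\<And>y. linear (J y)" "\<And>w. (\<lambda>y. J y w) differentiable (at z)"
    and p: "linear p"
    and B: "\<And>v w. v \<in> B \<Longrightarrow> w \<in> B \<Longrightarrow> p (nijenhuis_tensor J z v w) = 0"
    and "v \<in> span B" "w \<in> span B"
  shows "p (nijenhuis_tensor J z v w) = 0"
proof -
  have l: "linear (\<lambda>v. p (nijenhuis_tensor J z v w))" for w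
    using linear_compose[OF linear_nijenhuis_tensor[OF J] p] by (simp add: o_def)
  have 1: "p (nijenhuis_tensor J z v w) = 0" if "w \<in> B" for w
    by (rule linear_eq_0_on_span[OF l _ \<open>v \<in> span B\<close>]) (use B that in auto)
  have swap: "p (nijenhuis_tensor J z x y) = - p (nijenhuis_tensor J z y x)" for x y
    by (simp only: nijenhuis_tensor_swap[OF J(1), where w = x and v = y] linear_neg[OF p])
  have "p (nijenhuis_tensor J z w v) = 0"
  proof (rule linear_eq_0_on_span[OF l _ \<open>w \<in> span B\<close>])
    show "p (nijenhuis_tensor J z x v) = 0" if "x \<in> B" for x
      using 1[OF that] swap[of x v] by simp
  qed
  then show ?thesis
    using swap[of v w] by simp
qed

section \<open>Smoothness classes and functions constant along a line\<close>

lemma Ck_on_cong: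
  assumes "subspace E" "openin (top_of_set E) S" "\<And>y. y \<in> S \<Longrightarrow> f y = g y" "Ck_on m E S f"
  shows "Ck_on m E S g"
  using assms(3,4)
proof (induction m arbitrary: f g)
  case 0
  have "continuous_on S f"
    using 0(2) by (rule Ck_on.simps(1)[THEN iffD1])
  then have "continuous_on S g"
    by (rule continuous_on_eq) (rule 0(1))
  then show ?case
    by (rule Ck_on.simps(1)[THEN iffD2])
next
  case (Suc m)
  have "g differentiable at x within S" if "x \<in> S" for x
  proof -
    have "f differentiable (at x within S)"
      using Suc.prems(2) that by simp
    then obtain f' where "(f has_derivative f') (at x within S)"
      unfolding differentiable_def ..
    then have "(g has_derivative f') (at x within S)"
      by (rule has_derivative_transform[rotated 2]) (use Suc.prems(1) that in auto)
    then show ?thesis by (auto simp: differentiable_def)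
  qed
  moreover have "Ck_on m E S (\<lambda>x. dir_deriv g x v)" if "v \<in> E" for v
  proof (rule Suc.IH)
    show "dir_deriv f x v = dir_deriv g x v" if "x \<in> S" for x
      by (rule dir_deriv_cong[OF assms(1,2) that \<open>v \<in> E\<close> Suc.prems(1)])
    show "Ck_on m E S (\<lambda>x. dir_deriv f x v)"
      using Suc.prems(2) \<open>v \<in> E\<close> by simp
  qed
  ultimately show ?case by simp
qed

lemma Ck_on_const: "Ck_on m E S (\<lambda>x. c)"
  by (induction m arbitrary: c) auto

lemma smooth_on_const: "smooth_on E S (\<lambda>x. c)"
  by (simp add: smooth_on_def Ck_on_const)

text \<open>Gives smoothness of \<open>D_frame\<close>, whose only variable coefficient is a value
  of \<eta>. The constant \<open>c\<close> is general in the induction because differentiation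
  replaces it by \<open>0\<close>.\<close>

lemma Ck_on_affine:
  fixes f :: "'e::real_normed_vector \<Rightarrow> real"
  assumes "open S" "Ck_on m UNIV S f"
  shows "Ck_on m UNIV S (\<lambda>x. c - f x *\<^sub>R d)"
  using assms(2)
proof (induction m arbitrary: f c)
  case 0
  then show ?case by (simp add: continuous_on_diff continuous_on_scaleR continuous_on_const)
next
  case (Suc m)
  have f: "(f has_derivative dir_deriv f x) (at x)" if "x \<in> S" for x
  proof -
    have "f differentiable (at x within S)"
      using Suc.prems that by simp
    then show ?thesis
      unfolding at_within_open[OF that assms(1)] by (rule has_derivative_dir_deriv)
  qed
  have g: "((\<lambda>x. c - f x *\<^sub>R d) has_derivative (\<lambda>v. 0 - dir_deriv f x v *\<^sub>R d)) (at x)" if "x \<in> S" for x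
    by (intro has_derivative_diff has_derivative_const has_derivative_scaleR_left f that)
  have "Ck_on m UNIV S (\<lambda>x. dir_deriv (\<lambda>x. c - f x *\<^sub>R d) x v)" for v
    by (rule Ck_on_cong[OF _ _ _ Suc.IH[of "\<lambda>x. dir_deriv f x v" 0]])
      (use Suc.prems assms(1) dir_deriv_at[OF g] in auto)
  moreover have "(\<lambda>x. c - f x *\<^sub>R d) differentiable at x within S" if "x \<in> S" for x
    using g[OF that] by (meson differentiable_def has_derivative_at_withinI)
  ultimately show ?case by simp
qed

lemma smooth_on_differentiable:
  "smooth_on E S f \<Longrightarrow> x \<in> S \<Longrightarrow> f differentiable (at x within S)"
  unfolding smooth_on_def by (metis Ck_on.simps(2))

lemma smooth_on_differentiable_at:
  "smooth_on E S f \<Longrightarrow> x \<in> S \<Longrightarrow> open S \<Longrightarrow> f differentiable (at x)"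
  using smooth_on_differentiable[of E S f x] at_within_open[of x S] by simp

text \<open>On the line \<open>f\<close> has zero derivative. The segment is symmetric about
  \<open>0\<close>, which treats both signs of \<open>s\<close> together.\<close>

lemma constant_along_line:
  assumes S: "\<And>t. \<bar>t\<bar> \<le> \<bar>s\<bar> \<Longrightarrow> x + t *\<^sub>R v \<in> S"
    and f: "\<And>y. y \<in> S \<Longrightarrow> f differentiable (at y)" "\<And>y. y \<in> S \<Longrightarrow> dir_deriv f y v = 0"
  shows "f (x + s *\<^sub>R v) = f x"
proof -
  have d: "((\<lambda>t. f (x + t *\<^sub>R v)) has_derivative (\<lambda>h. 0)) (at t within {- \<bar>s\<bar>..\<bar>s\<bar>})"
    if "t \<in> {- \<bar>s\<bar>..\<bar>s\<bar>}" for t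
  proof -
    have y: "x + t *\<^sub>R v \<in> S" using S that by auto
    have D: "(f has_derivative dir_deriv f (x + t *\<^sub>R v)) (at (x + t *\<^sub>R v))"
      by (rule has_derivative_dir_deriv) (rule f(1)[OF y])
    have "((\<lambda>t::real. x + t *\<^sub>R v) has_derivative (\<lambda>h. h *\<^sub>R v)) (at t)"
      by (auto intro!: derivative_eq_intros)
    from has_derivative_compose[OF this D]
    have "((\<lambda>t. f (x + t *\<^sub>R v)) has_derivative (\<lambda>h. dir_deriv f (x + t *\<^sub>R v) (h *\<^sub>R v))) (at t)" .
    moreover have "(\<lambda>h. dir_deriv f (x + t *\<^sub>R v) (h *\<^sub>R v)) = (\<lambda>h. 0)"
      using linear_scale[OF has_derivative_linear[OF D]] f(2)[OF y] by simp
    ultimately show ?thesis by (simp add: has_derivative_at_withinI)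
  qed
  obtain c where "\<And>t. t \<in> {- \<bar>s\<bar>..\<bar>s\<bar>} \<Longrightarrow> f (x + t *\<^sub>R v) = c"
    using has_derivative_zero_constant[OF convex_real_interval(5) d] by blast
  moreover have "s \<in> {- \<bar>s\<bar>..\<bar>s\<bar>}" "0 \<in> {- \<bar>s\<bar>..\<bar>s\<bar>}" by auto
  ultimately have "f (x + s *\<^sub>R v) = c" "f (x + 0 *\<^sub>R v) = c" by blast+
  then show ?thesis by simp
qed

section \<open>Adapted charts of K-contact structures\<close>

lemma linear_on_UNIV: "linear_on_space UNIV f \<longleftrightarrow> linear f"
  by (auto simp: linear_on_space_def linear_iff)

lemma open_chart_image:
  assumes "smooth_manifold M" "model M = UNIV" "i \<in> charts M"
  shows "open (chart_image M i)"
proof -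
  have "compatible_chart M (chart_dom M i) (chart_map M i)"
    using assms unfolding smooth_manifold_def by blast
  then show ?thesis
    using assms(2) by (simp add: compatible_chart_def chart_image_def)
qed

text \<open>Both sides of the equivalence are conditions on each adapted chart separately, so one
  such chart is fixed.\<close>

locale K_contact_chart =
  fixes M :: "('i, 'm, real^'n::finite) manifold"
    and S :: "('i, real^'n) contact_data"
    and nab :: "('i, real^'n) connection"
    and k :: 'n and i :: 'i
  assumes manifold: "smooth_manifold M" and model: "model M = UNIV"
    and contact: "almost_contact_metric M S" and Killing: "K_contact M S"
    and connection: "intrinsic_metric_connection M S nab"
    and adapted: "adapted M S k i"
begin

abbreviation "U \<equiv> chart_image M i"
abbreviation "\<xi> \<equiv> (axis k 1 :: real^'n)"
abbreviation "\<eta> \<equiv> form S i"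
abbreviation "g \<equiv> metric S i"
abbreviation "e \<equiv> D_frame S k i"
abbreviation "\<Gamma> \<equiv> christoffel S nab k i"

lemma chart: "i \<in> charts M" and reeb_eq: "x \<in> U \<Longrightarrow> reeb S i x = \<xi>"
  using adapted by (auto simp: adapted_def)

lemma open_U: "open U"
  by (rule open_chart_image[OF manifold model chart])

lemma tensors: "smooth_tensors M S"
  using contact by (simp add: almost_contact_metric_def)

lemma
  shows linear_form: "x \<in> U \<Longrightarrow> linear (\<eta> x)"
    and linear_metric: "x \<in> U \<Longrightarrow> linear (g x v)" "x \<in> U \<Longrightarrow> linear (\<lambda>u. g x u v)"
    and smooth_form: "smooth_on UNIV U (\<lambda>x. \<eta> x v)"
    and smooth_metric: "smooth_on UNIV U (\<lambda>x. g x v w)"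
  using tensors chart model
  unfolding smooth_tensors_def Let_def linear_on_UNIV[symmetric] by auto

lemma differentiable_form: "x \<in> U \<Longrightarrow> (\<lambda>x. \<eta> x v) differentiable (at x)"
  by (rule smooth_on_differentiable_at[OF smooth_form _ open_U])

lemma differentiable_metric: "x \<in> U \<Longrightarrow> (\<lambda>x. g x v w) differentiable (at x)"
  by (rule smooth_on_differentiable_at[OF smooth_metric _ open_U])

lemma
  assumes "x \<in> U"
  shows form_reeb: "\<eta> x \<xi> = 1"
    and metric_sym: "g x v w = g x w v"
    and metric_nondegenerate: "(\<And>w. g x v w = 0) \<Longrightarrow> v = 0"
    and metric_reeb: "g x v \<xi> = \<eta> x v"
proof -
  have c: "\<eta> x (reeb S i x) = 1" "endo S i x (reeb S i x) = 0"
      "g x (endo S i x v) (endo S i x w) = g x v w - \<eta> x v * \<eta> x w" for v w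
    using contact chart model assms unfolding almost_contact_metric_def Let_def by blast+
  have p: "pseudo_Riemannian M S"
    using contact by (simp add: almost_contact_metric_def)
  show 1: "\<eta> x \<xi> = 1"
    using c(1) reeb_eq[OF assms] by simp
  show "g x v w = g x w v"
    using p chart model assms unfolding pseudo_Riemannian_def by blast
  show "(\<And>w. g x v w = 0) \<Longrightarrow> v = 0"
    using p chart model assms unfolding pseudo_Riemannian_def by blast
  \<comment> \<open>Compatibility of \<open>g\<close> with the endomorphism at
    \<open>w = \<xi>\<close>: the left side is zero because the endomorphism annihilates
    \<xi>.\<close>
  show "g x v \<xi> = \<eta> x v"
    using c(3)[of v \<xi>] c(2) reeb_eq[OF assms] 1 linear_0[OF linear_metric(1)[OF assms]] by simp
qed

text \<open>Expand d\<eta>(\<xi>, v) = 0 for a constant field \<open>v\<close>. Since \<eta>(\<xi>)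
  = 1 and \<xi> is constant in an adapted chart, only the derivative of \<eta>(v) along \<xi> is
  left.\<close>

lemma dir_deriv_form_reeb:
  assumes "x \<in> U"
  shows "dir_deriv (\<lambda>y. \<eta> y v) x \<xi> = 0"
proof -
  have "ext_deriv \<eta> (reeb S i) (\<lambda>y. v) x = 0"
    using contact chart model assms smooth_on_const
    unfolding almost_contact_metric_def smooth_field_def by blast
  moreover have "dir_deriv (\<lambda>y. \<eta> y (reeb S i y)) x v = 0"
    using dir_deriv_cong_open[OF open_U assms, of "\<lambda>y. \<eta> y (reeb S i y)" "\<lambda>y. 1" v]
    by (simp add: reeb_eq form_reeb)
  moreover have "dir_deriv (reeb S i) x v = 0"
    using dir_deriv_cong_open[OF open_U assms, of "reeb S i" "\<lambda>y. \<xi>" v] by (simp add: reeb_eq)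
  ultimately show ?thesis
    by (simp add: ext_deriv_def lie_bracket_def reeb_eq[OF assms] linear_0[OF linear_form[OF assms]])
qed

lemma D_frame_nth: "c \<noteq> k \<Longrightarrow> e a x $ c = (if a = c then 1 else 0)"
  by (simp add: D_frame_def axis_def)

lemma form_D_frame: "x \<in> U \<Longrightarrow> \<eta> x (e a x) = 0"
  by (simp add: D_frame_def linear_diff[OF linear_form] linear_scale[OF linear_form] form_reeb)

text \<open>Both sides agree in every component other than \<open>k\<close>, so they differ by a
  multiple of \<xi>; applying \<eta> shows that the multiple is zero.\<close>

lemma D_expansion:
  assumes "x \<in> U" "\<eta> x v = 0"
  shows "v = (\<Sum>a\<in>-{k}. v $ a *\<^sub>R e a x)"
proof -
  let ?s = "\<Sum>a\<in>-{k}. v $ a *\<^sub>R e a x"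
  have nth: "?s $ c = v $ c" if "c \<noteq> k" for c
    using that by (simp add: D_frame_nth if_distrib cong: if_cong)
  have d: "v - ?s = (v - ?s) $ k *\<^sub>R \<xi>"
    by (rule vec_eq_iff[THEN iffD2]) (auto simp: axis_def nth simp del: sum_component)
  have "\<eta> x (v - ?s) = 0"
    using assms by (simp add: linear_diff[OF linear_form] linear_sum[OF linear_form]
        linear_scale[OF linear_form] form_D_frame)
  then have "(v - ?s) $ k = 0"
    by (subst (asm) d)
      (simp add: linear_scale[OF linear_form[OF assms(1)]] form_reeb[OF assms(1)] del: vector_minus_component)
  then show ?thesis
    using d by simp
qed

lemma has_derivative_D_frame:
  assumes "x \<in> U"
  shows "(e a has_derivative (\<lambda>v. - (dir_deriv (\<lambda>y. \<eta> y (axis a 1)) x v *\<^sub>R \<xi>))) (at x)"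
proof -
  have "(e a has_derivative (\<lambda>v. 0 - dir_deriv (\<lambda>y. \<eta> y (axis a 1)) x v *\<^sub>R \<xi>)) (at x)"
    unfolding D_frame_def[abs_def]
    by (intro has_derivative_diff has_derivative_const has_derivative_scaleR_left
        has_derivative_dir_deriv differentiable_form assms)
  then show ?thesis by simp
qed

lemmas dir_deriv_D_frame = dir_deriv_at[OF has_derivative_D_frame]

section \<open>Brackets of the frame and the Christoffel symbols\<close>

lemma D_section_frame: "D_section M S i (e a)"
proof -
  have "smooth_on UNIV U (e a)"
    using smooth_form[of "axis a 1"] Ck_on_affine[OF open_U]
    unfolding smooth_on_def D_frame_def[abs_def] by blast
  then show ?thesis
    by (simp add: D_section_def smooth_field_def model form_D_frame)
qed

text \<open>Only the component \<open>k\<close> of the frame fields varies, so brackets point along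
  \<xi>. The projection to D annihilates them, which makes the connection symmetric on the
  frame.\<close>

lemma lie_bracket_D_frame:
  assumes "x \<in> U"
  shows "lie_bracket (e a) (e b) x =
    (dir_deriv (\<lambda>y. \<eta> y (axis a 1)) x (e b x) - dir_deriv (\<lambda>y. \<eta> y (axis b 1)) x (e a x)) *\<^sub>R \<xi>"
  by (simp add: lie_bracket_def dir_deriv_D_frame[OF assms] algebra_simps)

lemma
  assumes "x \<in> U"
  shows nab_metric: "dir_deriv (\<lambda>y. g y (e a y) (e b y)) x (e c x)
      = g x (nab i (e c) (e a) x) (e b x) + g x (e a x) (nab i (e c) (e b) x)"
    and nab_sym: "nab i (e a) (e b) x = nab i (e b) (e a) x"
    and smooth_nab: "smooth_on UNIV U (nab i (e a) (e b))"
    and form_nab: "\<eta> x (nab i (e a) (e b) x) = 0"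
proof -
  have D: "D_section M S i (nab i (e a) (e b))"
    and t: "nab i (e a) (e b) x - nab i (e b) (e a) x = proj_D S i x (lie_bracket (e a) (e b) x)"
    and m: "dir_deriv (\<lambda>y. g y (e a y) (e b y)) x (e c x)
      = g x (nab i (e c) (e a) x) (e b x) + g x (e a x) (nab i (e c) (e b) x)"
    \<comment> \<open>The axioms of the connection are stated jointly with a smooth function; the
      constant \<open>0\<close> is supplied for it.\<close>
    using connection chart D_section_frame assms smooth_on_const[of "model M" U "0::real"]
    unfolding intrinsic_metric_connection_def by blast+
  show "dir_deriv (\<lambda>y. g y (e a y) (e b y)) x (e c x)
      = g x (nab i (e c) (e a) x) (e b x) + g x (e a x) (nab i (e c) (e b) x)"
    by (rule m)
  show "nab i (e a) (e b) x = nab i (e b) (e a) x"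
    using t by (simp add: proj_D_def lie_bracket_D_frame[OF assms] linear_scale[OF linear_form[OF assms]]
        reeb_eq[OF assms] form_reeb[OF assms])
  show "smooth_on UNIV U (nab i (e a) (e b))" "\<eta> x (nab i (e a) (e b) x) = 0"
    using D assms by (auto simp: D_section_def smooth_field_def model)
qed

lemma christoffel_sym: "x \<in> U \<Longrightarrow> \<Gamma> c a b x = \<Gamma> c b a x"
  using nab_sym[of x a b] by (simp add: christoffel_def)

lemma nab_expansion:
  assumes "x \<in> U"
  shows "nab i (e a) (e b) x = (\<Sum>c\<in>-{k}. \<Gamma> c a b x *\<^sub>R e c x)"
  unfolding christoffel_def by (rule D_expansion[OF assms form_nab[OF assms]])

lemma differentiable_christoffel:
  assumes "x \<in> U"
  shows "\<Gamma> c a b differentiable (at x)"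
proof -
  have "nab i (e a) (e b) differentiable (at x)"
    by (rule smooth_on_differentiable_at[OF smooth_nab[OF assms] assms open_U])
  then show ?thesis
    unfolding differentiable_def christoffel_def[abs_def]
    using bounded_linear.has_derivative[OF bounded_linear_vec_nth] by blast
qed

section \<open>The frame metric, the Koszul formula and invariance along the Reeb field\<close>

abbreviation "G a b x \<equiv> g x (e a x) (e b x)"

text \<open>Metricity for the three arrangements of the frame fields is combined with symmetry; the
  usual bracket terms are absent since the frame brackets project to zero.\<close>

lemma Koszul:
  assumes "x \<in> U"
  shows "2 * g x (nab i (e a) (e b) x) (e c x)
    = dir_deriv (G b c) x (e a x) + dir_deriv (G a c) x (e b x) - dir_deriv (G a b) x (e c x)"
  using nab_metric[OF assms] nab_sym[OF assms] metric_sym[OF assms]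
  by (simp add: algebra_simps)

lemma metric_frame:
  assumes "x \<in> U"
  shows "G a b x = g x (axis a 1) (axis b 1) - \<eta> x (axis a 1) * \<eta> x (axis b 1)"
  using assms metric_sym[OF assms, of \<xi>] form_D_frame[OF assms, of a, unfolded D_frame_def]
  by (simp add: D_frame_def linear_diff[OF linear_metric(1)] linear_diff[OF linear_metric(2)]
      linear_scale[OF linear_metric(1)] linear_scale[OF linear_metric(2)] metric_reeb form_reeb
      algebra_simps)

lemma differentiable_metric_frame:
  assumes "x \<in> U"
  shows "G a b differentiable (at x)"
proof -
  have "(\<lambda>x. g x (axis a 1) (axis b 1) - \<eta> x (axis a 1) * \<eta> x (axis b 1)) differentiable (at x)"
    by (intro differentiable_diff differentiable_mult differentiable_metric differentiable_form assms)
  then obtain f' where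
    "((\<lambda>x. g x (axis a 1) (axis b 1) - \<eta> x (axis a 1) * \<eta> x (axis b 1)) has_derivative f') (at x)"
    unfolding differentiable_def ..
  then have "(G a b has_derivative f') (at x)"
    by (rule has_derivative_transform_within_open[OF _ open_U assms]) (simp add: metric_frame)
  then show ?thesis by (rule differentiableI)
qed

text \<open>The coefficients of the frame are constant along \<xi>, so \<xi> commutes with it and
  the Killing equation reduces to this derivative.\<close>

lemma dir_deriv_metric_frame_reeb:
  assumes "x \<in> U"
  shows "dir_deriv (G a b) x \<xi> = 0"
proof -
  have "smooth_field (model M) U (e a)" for a
    using D_section_frame by (simp add: D_section_def)
  then have "lie_deriv_metric (reeb S i) g (e a) (e b) x = 0"
    using Killing chart assms unfolding K_contact_def by blast
  moreover have "lie_bracket (reeb S i) (e a) x = 0" for a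
    using dir_deriv_cong_open[OF open_U assms, of "reeb S i" "\<lambda>y. \<xi>"] dir_deriv_form_reeb[OF assms]
    by (simp add: lie_bracket_def dir_deriv_D_frame[OF assms] reeb_eq assms)
  ultimately show ?thesis
    by (simp add: lie_deriv_metric_def reeb_eq[OF assms] linear_0[OF linear_metric(1)[OF assms]]
        linear_0[OF linear_metric(2)[OF assms]])
qed

text \<open>Finite translations replace second derivatives: if \<open>f\<close> is invariant under a
  translation near \<open>x\<close>, so are its directional derivatives, and derivatives along \<xi>
  and \<open>v\<close> never have to be interchanged.\<close>

lemma
  assumes f: "\<And>y. y \<in> U \<Longrightarrow> f differentiable (at y)" "\<And>y. y \<in> U \<Longrightarrow> dir_deriv f y \<xi> = 0"
    and x: "ball x r \<subseteq> U" "\<bar>s\<bar> < r"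
  shows shift_reeb: "f (x + s *\<^sub>R \<xi>) = f x"
    and dir_deriv_shift_reeb: "dir_deriv f (x + s *\<^sub>R \<xi>) v = dir_deriv f x v"
proof -
  \<comment> \<open>The smaller radius keeps translates by at most \<open>\<bar>s\<bar>\<close>
    inside \<open>ball x r\<close>. Invariance on a whole neighbourhood of \<open>x\<close> is what
    can be differentiated.\<close>
  have shift: "f (y + s *\<^sub>R \<xi>) = f y" if y: "y \<in> ball x (r - \<bar>s\<bar>)" for y
  proof (rule constant_along_line[of s y \<xi> U])
    fix t :: real assume t: "\<bar>t\<bar> \<le> \<bar>s\<bar>"
    have "norm (x - (y + t *\<^sub>R \<xi>)) \<le> norm (x - y) + norm (t *\<^sub>R \<xi>)"
      using norm_triangle_ineq4[of "x - y" "t *\<^sub>R \<xi>"] by (simp add: algebra_simps)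
    then show "y + t *\<^sub>R \<xi> \<in> U"
      using x(1) y t by (auto simp: dist_norm norm_axis_1)
  qed (use f in auto)
  from x(2) show "f (x + s *\<^sub>R \<xi>) = f x"
    by (intro shift) simp
  have "dir_deriv f (x + s *\<^sub>R \<xi>) v = dir_deriv (\<lambda>y. f (y + s *\<^sub>R \<xi>)) x v"
    by (simp add: dir_deriv_def add_ac)
  also have "\<dots> = dir_deriv f x v"
    by (rule dir_deriv_cong_open[of "ball x (r - \<bar>s\<bar>)"]) (use x(2) shift in auto)
  finally show "dir_deriv f (x + s *\<^sub>R \<xi>) v = dir_deriv f x v" .
qed

text \<open>D is orthogonal to \<xi> by \<open>metric_reeb\<close>, so splitting \<open>w\<close>
  into a part in D and a multiple of \<xi> reduces pairing with \<open>w\<close> to pairing with the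
  frame.\<close>

lemma metric_D_nondegenerate:
  assumes "x \<in> U" "\<eta> x v = 0" "\<And>c. c \<noteq> k \<Longrightarrow> g x v (e c x) = 0"
  shows "v = 0"
proof (rule metric_nondegenerate[OF assms(1)])
  fix w
  let ?w = "w - \<eta> x w *\<^sub>R \<xi>"
  note lin = linear_metric(1)[OF assms(1), of v]
  have "\<eta> x ?w = 0"
    by (simp add: linear_diff[OF linear_form] linear_scale[OF linear_form] form_reeb assms(1))
  then have "g x v ?w = g x v (\<Sum>a\<in>-{k}. ?w $ a *\<^sub>R e a x)"
    by (rule arg_cong[OF D_expansion[OF assms(1)]])
  also have "\<dots> = 0"
    unfolding linear_sum[OF lin] linear_scale[OF lin] by (intro sum.neutral) (simp add: assms(3))
  finally show "g x v w = 0"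
    by (simp add: linear_diff[OF lin] linear_scale[OF lin] metric_reeb assms)
qed

text \<open>By the Koszul formula the Christoffel symbols are built from quantities that the flow of
  the Reeb field preserves.\<close>

lemma christoffel_shift_reeb:
  assumes r: "ball x r \<subseteq> U" "\<bar>s\<bar> < r" and "c \<noteq> k"
  shows "\<Gamma> c a b (x + s *\<^sub>R \<xi>) = \<Gamma> c a b x"
proof -
  define x' where "x' = x + s *\<^sub>R \<xi>"
  have x: "x \<in> U" "x' \<in> U"
    using r by (auto simp: subset_iff x'_def dist_norm norm_axis_1)
  have e': "e d x' = e d x" for d
    using shift_reeb[OF differentiable_form dir_deriv_form_reeb r] by (simp add: D_frame_def x'_def)
  have G': "G d c x' = G d c x" for d c
    using shift_reeb[OF differentiable_metric_frame dir_deriv_metric_frame_reeb r] by (simp add: x'_def)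
  have dG': "dir_deriv (G d c) x' v = dir_deriv (G d c) x v" for d c v
    using dir_deriv_shift_reeb[OF differentiable_metric_frame dir_deriv_metric_frame_reeb r]
    by (simp add: x'_def)
  have nab: "g y (nab i (e a) (e b) y) (e c y) = (\<Sum>d\<in>-{k}. \<Gamma> d a b y * G d c y)" if "y \<in> U" for y c
    by (simp add: nab_expansion[OF that] linear_sum[OF linear_metric(2)[OF that]]
        linear_scale[OF linear_metric(2)[OF that]])
  \<comment> \<open>The frame has the same components at both points, so the covariant derivatives
    can be subtracted. By \<open>Koszul\<close> the difference is orthogonal to the frame, hence
    zero; its component \<open>c \<noteq> k\<close> is the difference of the symbols.\<close>
  define v where "v = (\<Sum>d\<in>-{k}. (\<Gamma> d a b x' - \<Gamma> d a b x) *\<^sub>R e d x)"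
  have "g x v (e c x) = (\<Sum>d\<in>-{k}. \<Gamma> d a b x' * G d c x') - (\<Sum>d\<in>-{k}. \<Gamma> d a b x * G d c x)" for c
    by (simp add: v_def linear_sum[OF linear_metric(2)[OF x(1)]]
        linear_scale[OF linear_metric(2)[OF x(1)]] G' left_diff_distrib sum_subtractf)
  moreover have "2 * (\<Sum>d\<in>-{k}. \<Gamma> d a b x' * G d c x') = 2 * (\<Sum>d\<in>-{k}. \<Gamma> d a b x * G d c x)" for c
    using Koszul[OF x(1), of a b c] Koszul[OF x(2), of a b c]
    unfolding nab[OF x(1)] nab[OF x(2)] unfolding dG' e' by simp
  moreover have "\<eta> x v = 0"
    by (simp add: v_def linear_sum[OF linear_form[OF x(1)]] linear_scale[OF linear_form[OF x(1)]]
        form_D_frame[OF x(1)])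
  ultimately have "v = 0"
    using metric_D_nondegenerate[OF x(1)] by simp
  moreover have "v $ c = \<Gamma> c a b x' - \<Gamma> c a b x"
    using \<open>c \<noteq> k\<close> by (simp add: v_def D_frame_nth if_distrib cong: if_cong)
  ultimately show ?thesis by (simp add: x'_def)
qed

lemma dir_deriv_christoffel_reeb:
  assumes "x \<in> U" "c \<noteq> k"
  shows "dir_deriv (\<Gamma> c a b) x \<xi> = 0"
proof -
  obtain r where r: "r > 0" "ball x r \<subseteq> U"
    using open_U assms(1) by (auto simp: open_contains_ball)
  have "\<forall>\<^sub>F t in nhds 0. \<bar>t\<bar> < r"
    using r(1) by (auto simp: eventually_nhds_metric dist_norm)
  then have "dir_deriv (\<Gamma> c a b) x \<xi> = vector_derivative (\<lambda>t::real. \<Gamma> c a b x) (at 0)"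
    unfolding dir_deriv_def
    by (intro vector_derivative_cong_eq)
      (auto elim!: eventually_mono simp: christoffel_shift_reeb[OF r(2) _ assms(2)])
  then show ?thesis by simp
qed

end

section \<open>Charts of the total space\<close>

context
  fixes M :: "('i, 'm, 'e::euclidean_space) manifold"
  assumes manifold: "smooth_manifold M" and model: "model M = UNIV"
begin

lemma transition_chart:
  assumes "i \<in> charts M" "q \<in> chart_dom M i"
  shows "transition (chart_dom M i) (chart_map M i) h (chart_map M i q) = h q"
proof -
  have "inj_on (chart_map M i) (chart_dom M i)"
    using manifold assms(1) by (simp add: smooth_manifold_def compatible_chart_def)
  then show ?thesis
    using assms(2) by (simp add: transition_def the_inv_into_f_f)
qed

lemma
  assumes "i \<in> charts M" "j \<in> charts M"
  shows open_chart_overlap: "open (chart_map M i ` (chart_dom M i \<inter> chart_dom M j))"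
    and differentiable_transition: "p \<in> chart_dom M i \<inter> chart_dom M j \<Longrightarrow>
      transition (chart_dom M i) (chart_map M i) (chart_map M j) differentiable (at (chart_map M i p))"
proof -
  have "compatible_chart M (chart_dom M i) (chart_map M i)"
    using manifold assms(1) by (simp add: smooth_manifold_def)
  then have c: "open (chart_map M i ` (chart_dom M i \<inter> chart_dom M j))"
      "smooth_on UNIV (chart_map M i ` (chart_dom M i \<inter> chart_dom M j))
        (transition (chart_dom M i) (chart_map M i) (chart_map M j))"
    using assms(2) model by (simp_all add: compatible_chart_def Let_def)
  show "open (chart_map M i ` (chart_dom M i \<inter> chart_dom M j))"
    by (rule c)
  show "transition (chart_dom M i) (chart_map M i) (chart_map M j) differentiable (at (chart_map M i p))"
    if "p \<in> chart_dom M i \<inter> chart_dom M j"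
    by (rule smooth_on_differentiable_at[OF c(2) _ c(1)]) (use that in blast)
qed

lemma change_of_chart_refl:
  assumes "i \<in> charts M" "p \<in> chart_dom M i"
  shows "change_of_chart M i i p v = v"
proof -
  have "change_of_chart M i i p v = dir_deriv (\<lambda>x. x) (chart_map M i p) v"
    unfolding change_of_chart_def
    by (rule dir_deriv_cong_open[OF open_chart_overlap[OF assms(1) assms(1)]])
      (use assms transition_chart[OF assms(1)] in auto)
  also have "\<dots> = v"
    by (rule dir_deriv_at[OF has_derivative_ident])
  finally show ?thesis .
qed

text \<open>Chain rule: on the overlap of charts \<open>i\<close> and \<open>j\<close> the composite
  of the two transition maps agrees with the transition map from \<open>i\<close> to
  \<open>l\<close>.\<close>

lemma change_of_chart_trans:
  assumes "i \<in> charts M" "j \<in> charts M" "l \<in> charts M"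
    and p: "p \<in> chart_dom M i" "p \<in> chart_dom M j" "p \<in> chart_dom M l"
  shows "change_of_chart M j l p (change_of_chart M i j p v) = change_of_chart M i l p v"
proof -
  define t where "t i j = transition (chart_dom M i) (chart_map M i) (chart_map M j)" for i j
  have D: "(t i j has_derivative change_of_chart M i j p) (at (chart_map M i p))"
    if "i \<in> charts M" "j \<in> charts M" "p \<in> chart_dom M i" "p \<in> chart_dom M j" for i j
    unfolding t_def change_of_chart_def
    by (intro has_derivative_dir_deriv differentiable_transition) (use that in auto)
  have "t i j (chart_map M i p) = chart_map M j p"
    using transition_chart assms by (simp add: t_def)
  then have "((\<lambda>x. t j l (t i j x)) has_derivative
      (\<lambda>v. change_of_chart M j l p (change_of_chart M i j p v))) (at (chart_map M i p))"
    using has_derivative_compose[OF D[of i j], of "t j l"] D[of j l] assms by simp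
  then have "change_of_chart M j l p (change_of_chart M i j p v)
      = dir_deriv (\<lambda>x. t j l (t i j x)) (chart_map M i p) v"
    using dir_deriv_at by metis
  also have "\<dots> = change_of_chart M i l p v"
    unfolding change_of_chart_def
    by (rule dir_deriv_cong_open[OF open_chart_overlap[OF assms(1,2)]])
      (use assms transition_chart in \<open>auto simp: t_def\<close>)
  finally show ?thesis .
qed

text \<open>The family is generated from its value in one chart; the cocycle rule
  \<open>change_of_chart_trans\<close> makes it compatible.\<close>

lemma tangent_vector_exists:
  assumes "i \<in> charts M" "p \<in> chart_dom M i"
  obtains v where "v \<in> tangent_space M p" "v i = w"
    "\<And>j. j \<in> charts M \<Longrightarrow> p \<in> chart_dom M j \<Longrightarrow> v j = change_of_chart M i j p w"
proof
  let ?v = "\<lambda>j. if j \<in> charts M \<and> p \<in> chart_dom M j then change_of_chart M i j p w else 0"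
  show "?v \<in> tangent_space M p"
    using assms change_of_chart_trans by (simp add: tangent_space_def model)
  show "?v i = w"
    using assms change_of_chart_refl by simp
qed auto

end

context K_contact_chart
begin

text \<open>The point is that the fibre coordinates are free: each admissible vector must come from
  a tangent vector in D given in all charts around \<open>p\<close>.\<close>

lemma chart_image_total_space:
  "chart_image (total_space M S k) i = {(x, y). x \<in> U \<and> y $ k = 0}"
proof (intro equalityI subsetI)
  fix z :: "(real^'n) \<times> (real^'n)" assume "z \<in> chart_image (total_space M S k) i"
  then show "z \<in> {(x, y). x \<in> U \<and> y $ k = 0}"
    by (auto simp: chart_image_def total_space_def)
next
  fix z :: "(real^'n) \<times> (real^'n)" assume z: "z \<in> {(x, y). x \<in> U \<and> y $ k = 0}"
  then obtain p where p: "p \<in> chart_dom M i" "fst z = chart_map M i p"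
    by (auto simp: chart_image_def)
  then have x: "chart_map M i p \<in> U"
    by (simp add: chart_image_def)
  \<comment> \<open>The lift of \<open>snd z\<close> to D along \<xi>. Only component
    \<open>k\<close> is altered, and the chart map discards it.\<close>
  let ?w = "snd z - \<eta> (chart_map M i p) (snd z) *\<^sub>R \<xi>"
  have w: "\<eta> (chart_map M i p) ?w = 0"
    by (simp add: linear_diff[OF linear_form] linear_scale[OF linear_form] form_reeb x)
  obtain v where v: "v \<in> tangent_space M p" "v i = ?w"
    "\<And>j. j \<in> charts M \<Longrightarrow> p \<in> chart_dom M j \<Longrightarrow> v j = change_of_chart M i j p ?w"
    using tangent_vector_exists[OF manifold model chart p(1)] by blast
  have "form S j (chart_map M j p) (v j) = 0" if j: "j \<in> charts M" "p \<in> chart_dom M j" for j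
  proof -
    have "form S j (chart_map M j p) (change_of_chart M i j p u) = \<eta> (chart_map M i p) u" for u
      using tensors chart p(1) j model unfolding smooth_tensors_def Let_def by blast
    then show ?thesis using v(3)[OF j] w by simp
  qed
  then have "(p, v) \<in> total_points M S"
    using v(1) p(1) chart by (auto simp: total_points_def points_def)
  moreover have "z = (chart_map M i p, \<chi> a. if a = k then 0 else v i $ a)"
    using z p(2) v(2) by (auto simp: prod_eq_iff vec_eq_iff axis_def)
  ultimately show "z \<in> chart_image (total_space M S k) i"
    using p(1) by (force simp: chart_image_def total_space_def)
qed

section \<open>Brackets of the prolonged frame\<close>

abbreviation "J \<equiv> endo (prolonged S nab k) i"
abbreviation "H \<equiv> hor S nab k i"
abbreviation "V \<equiv> (ver :: 'n \<Rightarrow> (real^'n) \<times> (real^'n))"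
abbreviation "u \<equiv> (u_field k :: (real^'n) \<times> (real^'n))"
abbreviation "R \<equiv> schouten_curvature S nab k i"

lemma J_eq: "J z w = (\<Sum>a\<in>-{k}. hor_coeff a w *\<^sub>R V a)
    - (\<Sum>a\<in>-{k}. ver_coeff S nab k i a z w *\<^sub>R H a z)"
  by (simp add: prolonged_def)

lemma linear_J: "linear (J z)"
proof -
  have h: "hor_coeff a (v + w) = hor_coeff a v + hor_coeff a w"
    "hor_coeff a (r *\<^sub>R w) = r * hor_coeff a w" for a :: 'n and v w r
    by (simp_all add: hor_coeff_def)
  have v: "ver_coeff S nab k i a z (v + w) = ver_coeff S nab k i a z v + ver_coeff S nab k i a z w"
    "ver_coeff S nab k i a z (r *\<^sub>R w) = r * ver_coeff S nab k i a z w" for a v w r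
    by (simp_all add: ver_coeff_def distrib_left distrib_right sum.distrib sum_distrib_left mult_ac)
  show ?thesis
    by (rule linearI)
      (simp_all add: J_eq h v scaleR_left_distrib sum.distrib scaleR_right_diff_distrib
        scaleR_sum_right)
qed

lemma
  assumes "a \<noteq> k"
  shows J_hor: "J z (H a z) = V a" and J_ver: "J z (V a) = - H a z"
proof -
  have d: "(\<Sum>c\<in>-{k}. (if a = c then 1 else 0) *\<^sub>R h c) = h a" for h :: "'n \<Rightarrow> (real^'n) \<times> (real^'n)"
  proof -
    have "(\<Sum>c\<in>-{k}. (if a = c then 1 else 0) *\<^sub>R h c) = (\<Sum>c\<in>-{k}. if a = c then h c else 0)"
      by (rule sum.cong) auto
    then show ?thesis using assms by simp
  qed
  show "J z (H a z) = V a" "J z (V a) = - H a z"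
    using assms by (simp_all add: J_eq frame_coeffs[where k = k] d)
qed

lemma J_u: "J z u = 0"
proof -
  have "hor_coeff a u = 0" "ver_coeff S nab k i a z u = 0" if "a \<in> -{k}" for a
    using that frame_coeffs(5)[where b = a and k = k] frame_coeffs(6)[where b = a and k = k and z = z]
    by auto
  then show ?thesis by (simp add: J_eq)
qed

section \<open>Derivatives and brackets of the prolonged frame\<close>

lemma has_derivative_christoffel_fst:
  assumes "fst z \<in> U"
  shows "((\<lambda>z. \<Gamma> c a b (fst z)) has_derivative (\<lambda>u. dir_deriv (\<Gamma> c a b) (fst z) (fst u))) (at z)"
  by (rule has_derivative_compose[OF has_derivative_fst[OF has_derivative_ident]
        has_derivative_dir_deriv[OF differentiable_christoffel[OF assms]]])

lemma has_derivative_snd_nth: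
  "((\<lambda>z. snd z $ c) has_derivative (\<lambda>w. snd w $ c)) (at (z :: (real^'n) \<times> (real^'n)))"
  by (intro bounded_linear.has_derivative[OF bounded_linear_vec_nth] has_derivative_snd
      has_derivative_ident)

lemma has_derivative_hor:
  assumes "fst z \<in> U"
  shows "(H a has_derivative (\<lambda>w. (- (dir_deriv (\<lambda>y. \<eta> y (axis a 1)) (fst z) (fst w) *\<^sub>R \<xi>),
      - (\<Sum>b\<in>-{k}. \<Sum>c\<in>-{k}. (\<Gamma> b a c (fst z) * snd w $ c
          + dir_deriv (\<Gamma> b a c) (fst z) (fst w) * snd z $ c) *\<^sub>R axis b 1)))) (at z)"
proof -
  have f: "((\<lambda>z. e a (fst z)) has_derivative
      (\<lambda>w. - (dir_deriv (\<lambda>y. \<eta> y (axis a 1)) (fst z) (fst w) *\<^sub>R \<xi>))) (at z)"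
    by (rule has_derivative_compose[OF has_derivative_fst[OF has_derivative_ident]
          has_derivative_D_frame[OF assms]])
  show ?thesis
    unfolding hor_def case_prod_beta
    by (intro has_derivative_Pair f has_derivative_minus has_derivative_sum
        has_derivative_scaleR_left has_derivative_mult has_derivative_christoffel_fst[OF assms]
        has_derivative_snd_nth)
qed

lemmas dir_deriv_hor = dir_deriv_at[OF has_derivative_hor]

lemma differentiable_hor: "fst z \<in> U \<Longrightarrow> H a differentiable (at z)"
  using has_derivative_hor by (rule differentiableI)

lemma differentiable_J:
  assumes "fst z \<in> U"
  shows "(\<lambda>z. J z w) differentiable (at z)"
proof -
  have c: "(\<lambda>z. \<Gamma> c a b (fst z)) differentiable (at z)" for a b c
    using has_derivative_christoffel_fst[OF assms] by (rule differentiableI)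
  have v: "(\<lambda>z. ver_coeff S nab k i a z w) differentiable (at z)" for a
    unfolding ver_coeff_def
    by (intro differentiable_add differentiable_const differentiable_sum differentiable_mult
        c differentiableI[OF has_derivative_snd_nth] finite ballI)
  show ?thesis
    unfolding J_eq
    by (intro differentiable_diff differentiable_const differentiable_sum differentiable_scaleR
        v differentiable_hor assms finite ballI)
qed

lemma snd_sum_ver: "(\<Sum>a\<in>A. r a *\<^sub>R V a) = (0, \<Sum>a\<in>A. r a *\<^sub>R axis a 1)"
  by (simp add: prod_eq_iff fst_sum snd_sum ver_def)

text \<open>The projection onto ker \<lambda> along the structure vector, where \<lambda> is \<eta>
  pulled back by \<open>fst\<close>.\<close>

definition proj ::
    "(real^'n) \<times> (real^'n) \<Rightarrow> (real^'n) \<times> (real^'n) \<Rightarrow> (real^'n) \<times> (real^'n)" where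
  "proj z w = w - \<eta> (fst z) (fst w) *\<^sub>R u"

context
  fixes z :: "(real^'n) \<times> (real^'n)"
  assumes z: "fst z \<in> U"
begin

text \<open>\<open>V b\<close> moves only the fibre coordinates, in which the fibre part of
  \<open>H a\<close> is linear with coefficients minus the Christoffel symbols.\<close>

lemma dir_deriv_hor_ver:
  assumes "b \<noteq> k"
  shows "dir_deriv (H a) z (V b) = - (\<Sum>d\<in>-{k}. \<Gamma> d a b (fst z) *\<^sub>R V d)"
proof -
  have [simp]: "dir_deriv (\<Gamma> d a c) (fst z) 0 = 0" "dir_deriv (\<lambda>y. \<eta> y v) (fst z) 0 = 0" for c d v
    using linear_0[OF has_derivative_linear[OF has_derivative_dir_deriv]]
      differentiable_christoffel[OF z] differentiable_form[OF z] by blast+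
  have "(\<Sum>c\<in>-{k}. (\<Gamma> d a c (fst z) * axis b 1 $ c) *\<^sub>R axis d (1::real))
      = \<Gamma> d a b (fst z) *\<^sub>R axis d 1" for d
  proof -
    have "(\<Sum>c\<in>-{k}. (\<Gamma> d a c (fst z) * axis b 1 $ c) *\<^sub>R axis d (1::real))
      = (\<Sum>c\<in>-{k}. if c = b then \<Gamma> d a b (fst z) *\<^sub>R axis d 1 else 0)"
      by (rule sum.cong) (auto simp: axis_def)
    then show ?thesis using assms by simp
  qed
  then show ?thesis
    by (simp add: dir_deriv_hor[OF z] snd_sum_ver ver_def[of b])
qed

text \<open>The Killing condition enters here through the Christoffel symbols; the coefficients of
  \<eta> are constant along \<xi> because d\<eta>(\<xi>, v) = 0.\<close>

lemma dir_deriv_hor_u: "dir_deriv (H a) z u = 0"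
  by (simp add: dir_deriv_hor[OF z] u_field_def dir_deriv_form_reeb[OF z]
      dir_deriv_christoffel_reeb[OF z] prod_eq_iff)

lemma lie_bracket_hor_ver:
  "b \<noteq> k \<Longrightarrow> lie_bracket (H a) (\<lambda>_. V b) z = (\<Sum>d\<in>-{k}. \<Gamma> d a b (fst z) *\<^sub>R V d)"
  by (simp add: lie_bracket_def dir_deriv_hor_ver)

lemma lie_bracket_u_hor: "lie_bracket (\<lambda>_. u) (H a) z = 0"
  by (simp add: lie_bracket_def dir_deriv_hor_u)

lemma snd_hor_nth:
  assumes "c \<noteq> k"
  shows "snd (H a z) $ c = - (\<Sum>f\<in>-{k}. \<Gamma> c a f (fst z) * snd z $ f)"
proof -
  have "(\<Sum>b\<in>-{k}. \<Sum>f\<in>-{k}. (\<Gamma> b a f (fst z) * snd z $ f) * axis b 1 $ c)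
      = (\<Sum>b\<in>-{k}. if b = c then \<Sum>f\<in>-{k}. \<Gamma> c a f (fst z) * snd z $ f else 0)"
    by (rule sum.cong) (auto simp: axis_def)
  then show ?thesis
    using assms by (simp add: hor_def case_prod_beta)
qed

text \<open>The multiplier \<open>r\<close> stays unspecified because both \<open>J z\<close> and
  \<open>proj z\<close> annihilate \<open>u\<close>.\<close>

lemma lie_bracket_hor_hor:
  obtains r where "lie_bracket (H a) (H b) z
    = r *\<^sub>R u - (\<Sum>d\<in>-{k}. (\<Sum>c\<in>-{k}. R d a b c (fst z) * snd z $ c) *\<^sub>R V d)"
proof -
  let ?x = "fst z"
  \<comment> \<open>Up to sign, \<open>q a b d\<close> is the fibre component \<open>d\<close> of
    the derivative of \<open>H b\<close> along \<open>H a\<close>. Moving the fibre point along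
    \<open>H a\<close> produces the quadratic terms of the curvature.\<close>
  define q where "q a b d = (\<Sum>c\<in>-{k}. \<Gamma> d b c ?x * snd (H a z) $ c
      + dir_deriv (\<Gamma> d b c) ?x (e a ?x) * snd z $ c)" for a b d
  have q: "q a b d = (\<Sum>c\<in>-{k}. (dir_deriv (\<Gamma> d b c) ?x (e a ?x)
      - (\<Sum>f\<in>-{k}. \<Gamma> d b f ?x * \<Gamma> f a c ?x)) * snd z $ c)" for a b d
  proof -
    have "(\<Sum>c\<in>-{k}. \<Gamma> d b c ?x * snd (H a z) $ c)
        = - (\<Sum>c\<in>-{k}. \<Sum>f\<in>-{k}. \<Gamma> d b c ?x * \<Gamma> c a f ?x * snd z $ f)"
      by (simp add: snd_hor_nth sum_distrib_left sum_negf mult_ac)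
    also have "(\<Sum>c\<in>-{k}. \<Sum>f\<in>-{k}. \<Gamma> d b c ?x * \<Gamma> c a f ?x * snd z $ f)
        = (\<Sum>c\<in>-{k}. (\<Sum>f\<in>-{k}. \<Gamma> d b f ?x * \<Gamma> f a c ?x) * snd z $ c)"
      by (subst sum.swap) (simp add: sum_distrib_right)
    finally show ?thesis
      by (simp add: q_def sum.distrib left_diff_distrib sum_subtractf)
  qed
  have qR: "q a b d - q b a d = (\<Sum>c\<in>-{k}. R d a b c ?x * snd z $ c)" for d
    unfolding q sum_subtractf[symmetric] left_diff_distrib[symmetric]
    by (rule sum.cong) (simp_all add: schouten_curvature_def Let_def sum_subtractf algebra_simps)
  have D: "dir_deriv (H b) z (H a z)
      = (- (dir_deriv (\<lambda>y. \<eta> y (axis b 1)) ?x (e a ?x) *\<^sub>R \<xi>), - (\<Sum>d\<in>-{k}. q a b d *\<^sub>R axis d 1))" for a b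
    unfolding dir_deriv_hor[OF z] q_def scaleR_sum_left by (simp add: hor_def case_prod_beta)
  have "lie_bracket (H a) (H b) z = (dir_deriv (\<lambda>y. \<eta> y (axis a 1)) ?x (e b ?x)
        - dir_deriv (\<lambda>y. \<eta> y (axis b 1)) ?x (e a ?x)) *\<^sub>R u
      - (\<Sum>d\<in>-{k}. (q a b d - q b a d) *\<^sub>R V d)"
    by (simp add: lie_bracket_def D snd_sum_ver u_field_def scaleR_left_diff_distrib sum_subtractf)
  then show ?thesis
    unfolding qR by (rule that)
qed

section \<open>The torsion of \<open>J\<close> on the frame, up to multiples of
  \<open>u\<close>\<close>

lemma linear_proj: "linear (proj z)"
  by (rule linearI)
    (simp_all add: proj_def linear_add[OF linear_form[OF z]] linear_scale[OF linear_form[OF z]]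
      scaleR_left_distrib scaleR_right_diff_distrib)

lemma form_0: "\<eta> (fst z) 0 = 0"
  by (rule linear_0[OF linear_form[OF z]])

lemma proj_simps: "proj z u = 0" "proj z (V a) = V a" "proj z (H a z) = H a z" "proj z 0 = 0"
  by (simp_all add: proj_def u_field_def form_reeb[OF z] ver_def form_0 hor_def case_prod_beta
      form_D_frame[OF z] zero_prod_def[symmetric])

lemma J_sum_ver: "J z (\<Sum>a\<in>-{k}. r a *\<^sub>R V a) = - (\<Sum>a\<in>-{k}. r a *\<^sub>R H a z)"
  by (simp add: linear_sum[OF linear_J] linear_scale[OF linear_J] J_ver sum_negf)

lemmas J_linear_simps = linear_0[OF linear_J] linear_neg[OF linear_J] linear_diff[OF linear_J]
  linear_scale[OF linear_J]

text \<open>As \<open>J\<close> sends \<open>V a\<close> to \<open>- H a z\<close>, the two mixed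
  terms cancel by symmetry of the Christoffel symbols, and vertical fields commute. Only the bracket
  of \<open>H a\<close> and \<open>H b\<close> survives.\<close>

lemma nijenhuis_ver_ver:
  assumes "a \<noteq> k" "b \<noteq> k"
  shows "proj z (nijenhuis J (\<lambda>_. V a) (\<lambda>_. V b) z)
    = - (\<Sum>d\<in>-{k}. (\<Sum>c\<in>-{k}. R d a b c (fst z) * snd z $ c) *\<^sub>R V d)"
proof -
  obtain r where r: "lie_bracket (H a) (H b) z
    = r *\<^sub>R u - (\<Sum>d\<in>-{k}. (\<Sum>c\<in>-{k}. R d a b c (fst z) * snd z $ c) *\<^sub>R V d)"
    by (rule lie_bracket_hor_hor)
  have HH: "lie_bracket (\<lambda>y. - H a y) (\<lambda>y. - H b y) z = lie_bracket (H a) (H b) z"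
    by (simp add: lie_bracket_minus lie_bracket_swap[of "H a" "\<lambda>y. - H b y"]
        lie_bracket_swap[of "H a" "H b"] differentiable_hor z differentiable_minus)
  have HV: "lie_bracket (\<lambda>y. - H a y) (\<lambda>_. V b) z = - (\<Sum>d\<in>-{k}. \<Gamma> d a b (fst z) *\<^sub>R V d)"
    if "b \<noteq> k" for a b
    using that by (simp add: lie_bracket_minus differentiable_hor z lie_bracket_hor_ver)
  have "nijenhuis J (\<lambda>_. V a) (\<lambda>_. V b) z = lie_bracket (H a) (H b) z"
    using assms HV[of b a] HV[of a b]
    by (simp add: nijenhuis_def J_ver HH lie_bracket_const lie_bracket_swap[of "\<lambda>_. V a" "\<lambda>y. - H b y"]
        J_linear_simps christoffel_sym[OF z, of _ a b])
  then show ?thesis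
    unfolding r
    by (simp add: linear_diff[OF linear_proj] linear_scale[OF linear_proj] linear_sum[OF linear_proj]
        proj_simps)
qed

text \<open>Antisymmetry leaves six kinds of pairs. The tensor itself vanishes on all but the pair
  of two vertical vectors, where a multiple of \<open>u\<close> may remain; hence the
  projection.\<close>

lemma nijenhuis_tensor_frame:
  assumes R0: "\<And>a b c d. a \<noteq> k \<Longrightarrow> b \<noteq> k \<Longrightarrow> c \<noteq> k \<Longrightarrow> d \<noteq> k \<Longrightarrow> R d a b c (fst z) = 0"
    and B: "B = insert u (V ` (-{k}) \<union> (\<lambda>a. H a z) ` (-{k}))"
    and "v \<in> B" "w \<in> B"
  shows "proj z (nijenhuis_tensor J z v w) = 0"
proof -
  \<comment> \<open>The tensor is evaluated through the frame fields, whose brackets are known. The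
    ambient space can be used since \<open>J\<close> is linear at every point and differentiable at
    \<open>z\<close> in all directions.\<close>
  have N: "nijenhuis J X Y z = nijenhuis_tensor J z (X z) (Y z)"
    if "X differentiable (at z)" "Y differentiable (at z)" for X Y
    by (rule nijenhuis_eq_tensor[of UNIV UNIV]) (use that linear_J differentiable_J[OF z] in auto)
  note diff = differentiable_hor[OF z] differentiable_const
  note swap = nijenhuis_tensor_swap[of J z, OF linear_J]
  have HV: "lie_bracket (\<lambda>_. V b) (H a) z = - (\<Sum>d\<in>-{k}. \<Gamma> d a b (fst z) *\<^sub>R V d)" if "b \<noteq> k" for a b
    using that lie_bracket_swap[of "\<lambda>_. V b" "H a" z] by (simp add: lie_bracket_hor_ver)
  have minus_H: "lie_bracket X (\<lambda>y. - H a y) z = - lie_bracket X (H a) z"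
    if "X differentiable (at z)" for X a
    using that lie_bracket_swap[of X "\<lambda>y. - H a y" z] lie_bracket_swap[of X "H a" z]
    by (simp add: lie_bracket_minus diff)
  have zero: "lie_bracket (\<lambda>_. 0) X z = 0" if "X differentiable (at z)" for X
    using linear_0[OF has_derivative_linear[OF has_derivative_dir_deriv[OF that]]]
    by (simp add: lie_bracket_def)
  have HH: "J z (lie_bracket (H a) (H b) z) = 0" if "a \<noteq> k" "b \<noteq> k" for a b
  proof -
    obtain r where r: "lie_bracket (H a) (H b) z
      = r *\<^sub>R u - (\<Sum>d\<in>-{k}. (\<Sum>c\<in>-{k}. R d a b c (fst z) * snd z $ c) *\<^sub>R V d)"
      by (rule lie_bracket_hor_hor)
    show ?thesis
      unfolding r using R0 that by (simp add: J_linear_simps J_u)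
  qed
  have uu: "nijenhuis_tensor J z u u = 0"
    using N[of "\<lambda>_. u" "\<lambda>_. u"] by (simp add: nijenhuis_def J_u lie_bracket_const J_linear_simps)
  have uH: "nijenhuis_tensor J z u (H a z) = 0" if "a \<noteq> k" for a
    using N[of "\<lambda>_. u" "H a"] that
    by (simp add: nijenhuis_def J_u J_hor lie_bracket_const J_linear_simps diff zero lie_bracket_u_hor)
  have uV: "nijenhuis_tensor J z u (V a) = 0" if "a \<noteq> k" for a
    using N[of "\<lambda>_. u" "\<lambda>_. V a"] that
    by (simp add: nijenhuis_def J_u J_ver lie_bracket_const J_linear_simps diff zero
        lie_bracket_u_hor minus_H differentiable_minus)
  have VV: "proj z (nijenhuis_tensor J z (V a) (V b)) = 0" if "a \<noteq> k" "b \<noteq> k" for a b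
    using N[of "\<lambda>_. V a" "\<lambda>_. V b"] nijenhuis_ver_ver[OF that] R0 that by simp
  have HHN: "nijenhuis_tensor J z (H a z) (H b z) = 0" if "a \<noteq> k" "b \<noteq> k" for a b
    using N[of "H a" "H b"] that
    by (simp add: nijenhuis_def J_hor lie_bracket_const HH HV lie_bracket_hor_ver J_linear_simps diff
        christoffel_sym[OF z, of _ a b])
  have HVN: "nijenhuis_tensor J z (H a z) (V b) = 0" if "a \<noteq> k" "b \<noteq> k" for a b
    using N[of "H a" "\<lambda>_. V b"] that
    by (simp add: nijenhuis_def J_hor J_ver lie_bracket_const HH HV lie_bracket_hor_ver J_sum_ver
        J_linear_simps diff minus_H linear_sum[OF linear_J] sum_negf christoffel_sym[OF z, of _ a b])
  have swap0: "proj z (nijenhuis_tensor J z y x) = 0" if "nijenhuis_tensor J z x y = 0" for x y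
    using that swap[of y x] by (simp add: proj_simps)
  have cases: "x = u \<or> (\<exists>a. a \<noteq> k \<and> x = V a) \<or> (\<exists>a. a \<noteq> k \<and> x = H a z)" if "x \<in> B" for x
    using that unfolding B by blast
  show ?thesis
    using cases[OF assms(3)] cases[OF assms(4)]
    by (elim disjE exE conjE) (simp_all add: proj_simps uu uH uV VV HHN HVN swap0)
qed

text \<open>Horizontal vectors absorb the base components other than \<open>k\<close>, and
  \<open>u\<close> absorbs that one. The remainder is a fibre vector without component
  \<open>k\<close>, a combination of vertical vectors.\<close>

lemma span_frame:
  assumes "snd v $ k = 0"
  shows "v \<in> span (insert u (V ` (-{k}) \<union> (\<lambda>a. H a z) ` (-{k})))"
proof -
  let ?B = "insert u (V ` (-{k}) \<union> (\<lambda>a. H a z) ` (-{k}))"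
  have V: "(0, y) \<in> span ?B" if "y $ k = 0" for y :: "real^'n"
  proof -
    have "(0, y) = (\<Sum>a\<in>-{k}. y $ a *\<^sub>R V a)"
      unfolding snd_sum_ver
      using that by (auto simp: vec_eq_iff axis_def if_distrib cong: if_cong)
    also have "\<dots> \<in> span ?B"
      by (intro span_sum span_scale span_base) auto
    finally show ?thesis .
  qed
  let ?h = "\<Sum>a\<in>-{k}. fst v $ a *\<^sub>R H a z"
  have "snd (H a z) $ k = 0" for a
    by (simp add: hor_def case_prod_beta axis_def)
  then have snd: "snd (v - ?h) $ k = 0"
    using assms by (simp add: snd_sum)
  have "fst (v - ?h) $ c = 0" if "c \<noteq> k" for c
    using that by (simp add: fst_sum hor_def case_prod_beta D_frame_nth if_distrib cong: if_cong)
  then have "fst (v - ?h) = fst (v - ?h) $ k *\<^sub>R \<xi>"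
    unfolding vec_eq_iff by (auto simp: axis_def simp del: sum_component fst_diff)
  then have "v = ?h + (fst (v - ?h) $ k *\<^sub>R u + (0, snd (v - ?h)))"
    by (simp add: prod_eq_iff u_field_def del: vector_minus_component)
  also have "\<dots> \<in> span ?B"
    using V[OF snd] by (intro span_add span_sum span_scale) (auto intro: span_base)
  finally show ?thesis .
qed

lemma proj_nijenhuis_0:
  assumes R0: "\<And>a b c d. a \<noteq> k \<Longrightarrow> b \<noteq> k \<Longrightarrow> c \<noteq> k \<Longrightarrow> d \<noteq> k \<Longrightarrow> R d a b c (fst z) = 0"
    and "snd v $ k = 0" "snd w $ k = 0"
  shows "proj z (nijenhuis_tensor J z v w) = 0"
  by (rule nijenhuis_tensor_span_0[OF linear_J differentiable_J[OF z] linear_proj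
        nijenhuis_tensor_frame[OF R0 refl] span_frame[OF assms(2)] span_frame[OF assms(3)]])

end

section \<open>Almost normality in one adapted chart of the total space\<close>

abbreviation "T \<equiv> total_space M S k"

lemma model_total_space: "model T = {z. snd z $ k = 0}"
  by (auto simp: total_space_def)

lemma in_chart_image_total: "z \<in> chart_image T i \<longleftrightarrow> fst z \<in> U \<and> snd z $ k = 0"
  by (cases z) (simp add: chart_image_total_space)

lemma subspace_model_total: "subspace (model T)"
  by (simp add: model_total_space subspace_def)

lemma openin_chart_image_total: "openin (top_of_set (model T)) (chart_image T i)"
proof -
  have "chart_image T i = model T \<inter> (U \<times> UNIV)"
    by (auto simp: chart_image_total_space model_total_space)
  then show ?thesis
    using openin_open_Int[OF open_Times[OF open_U open_UNIV]] by simp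
qed

lemma J_in_model: "J z w \<in> model T"
  by (simp add: model_total_space J_eq snd_sum ver_def hor_def case_prod_beta axis_def)

lemma almost_normal_expression:
  assumes z: "z \<in> chart_image T i"
    and X: "smooth_field (model T) (chart_image T i) X"
    and Y: "smooth_field (model T) (chart_image T i) Y"
  shows "nijenhuis J X Y z + (2 * ext_deriv (form (prolonged S nab k) i)
      (\<lambda>y. J y (X y)) (\<lambda>y. J y (Y y)) z) *\<^sub>R reeb (prolonged S nab k) i z
    = proj z (nijenhuis J X Y z)"
proof -
  let ?lam = "form (prolonged S nab k) i"
  have z1: "fst z \<in> U"
    using z by (simp add: in_chart_image_total)
  have l: "?lam y w = \<eta> (fst y) (fst w)" for y w
    by (simp add: prolonged_def)
  have lJ: "?lam y (J y w) = 0" if "fst y \<in> U" for y w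
    by (simp add: l J_eq ver_def fst_sum hor_def case_prod_beta linear_neg[OF linear_form[OF that]]
        linear_sum[OF linear_form[OF that]] linear_scale[OF linear_form[OF that]]
        form_D_frame[OF that] linear_0[OF linear_form[OF that]])
  \<comment> \<open>The direction \<open>J z w\<close> lies in the model, so the derivative sees
    only the chart image, where \<lambda> vanishes on the image of \<open>J\<close>.\<close>
  have 0: "dir_deriv (\<lambda>y. ?lam y (J y (W y))) z (J z w) = 0" for W w
    using dir_deriv_cong[OF subspace_model_total openin_chart_image_total z J_in_model,
        of "\<lambda>y. ?lam y (J y (W y))" "\<lambda>y. 0"] lJ
    by (simp add: in_chart_image_total)
  \<comment> \<open>Every term of the torsion except the first bracket lies in the image of
    \<open>J z\<close>, hence in ker \<lambda>.\<close>
  have "\<eta> (fst z) (fst (nijenhuis J X Y z))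
      = ?lam z (lie_bracket (\<lambda>y. J y (X y)) (\<lambda>y. J y (Y y)) z)"
    using lJ[OF z1]
    by (simp add: nijenhuis_def l linear_add[OF linear_form[OF z1]] linear_diff[OF linear_form[OF z1]])
  then show ?thesis
    by (simp add: ext_deriv_def 0 proj_def) (simp add: prolonged_def)
qed

text \<open>For necessity the constant vertical fields suffice as test fields; for sufficiency
  tensoriality reduces arbitrary fields to their values at the point.\<close>

lemma almost_normal_chart:
  "(\<forall>X Y. smooth_field (model T) (chart_image T i) X \<and> smooth_field (model T) (chart_image T i) Y \<longrightarrow>
     (\<forall>z\<in>chart_image T i. nijenhuis J X Y z + (2 * ext_deriv (form (prolonged S nab k) i)
        (\<lambda>y. J y (X y)) (\<lambda>y. J y (Y y)) z) *\<^sub>R reeb (prolonged S nab k) i z = 0))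
   \<longleftrightarrow> (\<forall>x\<in>U. \<forall>a\<in>-{k}. \<forall>b\<in>-{k}. \<forall>c\<in>-{k}. \<forall>d\<in>-{k}. R d a b c x = 0)"
  (is "?normal \<longleftrightarrow> ?flat")
proof
  assume normal: ?normal
  show ?flat
  proof (intro ballI)
    fix x a b c d assume x: "x \<in> U" and ks: "a \<in> -{k}" "b \<in> -{k}" "c \<in> -{k}" "d \<in> -{k}"
    \<comment> \<open>With the unit vector of index \<open>c\<close> as fibre coordinate, the
      contraction with the curvature picks out one coefficient; \<open>c \<noteq> k\<close> puts the
      point in the chart image.\<close>
    have z: "(x, axis c 1) \<in> chart_image T i"
      using x ks by (simp add: in_chart_image_total axis_def)
    have V: "smooth_field (model T) (chart_image T i) (\<lambda>_. V a)" if "a \<in> -{k}" for a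
      using that by (simp add: smooth_field_def smooth_on_const model_total_space ver_def axis_def)
    have "proj (x, axis c 1) (nijenhuis J (\<lambda>_. V a) (\<lambda>_. V b) (x, axis c 1)) = 0"
      using normal[rule_format, OF conjI[OF V[OF ks(1)] V[OF ks(2)]] z]
      unfolding almost_normal_expression[OF z V[OF ks(1)] V[OF ks(2)]] .
    then have "(\<Sum>d\<in>-{k}. (\<Sum>f\<in>-{k}. R d a b f x * axis c 1 $ f) *\<^sub>R V d) = 0"
      using nijenhuis_ver_ver[of "(x, axis c 1)" a b] x ks by simp
    then have "snd (\<Sum>d\<in>-{k}. (\<Sum>f\<in>-{k}. R d a b f x * axis c 1 $ f) *\<^sub>R V d) $ d = 0"
      by (simp only: snd_zero zero_index)
    then have "(\<Sum>d\<in>-{k}. (\<Sum>f\<in>-{k}. R d a b f x * axis c 1 $ f) *\<^sub>R axis d (1::real)) $ d = 0"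
      unfolding snd_sum_ver snd_conv .
    moreover have "(\<Sum>f\<in>-{k}. R d a b f x * axis c 1 $ f) = R d a b c x" for d
    proof -
      have "(\<Sum>f\<in>-{k}. R d a b f x * axis c 1 $ f) = (\<Sum>f\<in>-{k}. if f = c then R d a b c x else 0)"
        by (rule sum.cong) (auto simp: axis_def)
      then show ?thesis using ks by simp
    qed
    moreover have "(\<Sum>d'\<in>-{k}. R d' a b c x *\<^sub>R axis d' (1::real)) $ d = R d a b c x"
    proof -
      have "(\<Sum>d'\<in>-{k}. R d' a b c x *\<^sub>R axis d' (1::real)) $ d
          = (\<Sum>d'\<in>-{k}. if d' = d then R d a b c x else 0)"
        unfolding sum_component by (rule sum.cong) (auto simp: axis_def)
      then show ?thesis using ks by simp
    qed
    ultimately show "R d a b c x = 0" by simp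
  qed
next
  assume flat: ?flat
  show ?normal
  proof (intro allI impI ballI, elim conjE)
    fix X Y z
    assume X: "smooth_field (model T) (chart_image T i) X"
      and Y: "smooth_field (model T) (chart_image T i) Y" and z: "z \<in> chart_image T i"
    have z1: "fst z \<in> U"
      using z by (simp add: in_chart_image_total)
    have XY: "X z \<in> model T" "Y z \<in> model T"
      "X differentiable (at z within chart_image T i)" "Y differentiable (at z within chart_image T i)"
      using X Y z by (auto simp: smooth_field_def intro: smooth_on_differentiable)
    \<comment> \<open>Arbitrary fields are differentiable only within the chart image, so
      tensoriality is applied relative to the model subspace. It yields the same pointwise
      expression as the ambient computation on the frame.\<close>
    have "nijenhuis J X Y z = nijenhuis_tensor J z (X z) (Y z)"
    proof (rule nijenhuis_eq_tensor[OF subspace_model_total openin_chart_image_total z])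
      show "(\<lambda>y. J y w) differentiable (at z within chart_image T i)" for w
        by (rule differentiable_at_withinI[OF differentiable_J[OF z1]])
    qed (use XY linear_J J_in_model in auto)
    then have "proj z (nijenhuis J X Y z) = 0"
      using proj_nijenhuis_0[OF z1, of "X z" "Y z"] flat z1 XY(1,2) by (simp add: model_total_space)
    then show "nijenhuis J X Y z + (2 * ext_deriv (form (prolonged S nab k) i)
        (\<lambda>y. J y (X y)) (\<lambda>y. J y (Y y)) z) *\<^sub>R reeb (prolonged S nab k) i z = 0"
      using almost_normal_expression[OF z X Y] by simp
  qed
qed

end

theorem theorem5:
  fixes M :: "('i, 'm, real^'n::finite) manifold"
    and S :: "('i, real^'n) contact_data"
    and nab :: "('i, real^'n) connection"
    and k :: 'n
  assumes "smooth_manifold M" and "model M = UNIV" and "odd CARD('n)"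
    and "contact_metric M S" and "K_contact M S"
    and "intrinsic_metric_connection M S nab"
  shows "almost_normal (total_space M S k) (prolonged S nab k) \<longleftrightarrow> zero_curvature M S nab k"
proof -
  have "K_contact_chart M S nab k i" if "adapted M S k i" for i
    using assms that by unfold_locales (simp_all add: contact_metric_def)
  note chart = K_contact_chart.almost_normal_chart[OF this]
  \<comment> \<open>The atlas of the total space is indexed by the adapted charts of the base, the
    index set of \<open>zero_curvature\<close>, so the chartwise equivalence settles the
    claim.\<close>
  have T: "charts (total_space M S k) = {i. adapted M S k i}"
    by (simp add: total_space_def)
  have "almost_normal (total_space M S k) (prolonged S nab k) \<longleftrightarrow>
      (\<forall>i\<in>{i. adapted M S k i}. \<forall>x\<in>chart_image M i.
        \<forall>a\<in>-{k}. \<forall>b\<in>-{k}. \<forall>c\<in>-{k}. \<forall>d\<in>-{k}. schouten_curvature S nab k i d a b c x = 0)"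
    unfolding almost_normal_def T by (rule ball_cong[OF refl], rule chart) simp
  then show ?thesis
    unfolding zero_curvature_def by blast
qed

end
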